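(* Let $M$ be a 2-semidominant ideal. Let $B=\{m : m \text{ is the multidegree of more than one basis element of } \mathbb{T}_M\}$. For each $m\in B$, let $B_m$ be the set of basis elements $[\sigma]$ of $\mathbb{T}_M$ with $\operatorname{mdeg}[\sigma]=m$. Then $M$ is Scarf if and only if $\#(B_m)$ is even for all $m\in B$.
   Context: $S$ is a polynomial ring in finitely many variables over an arbitrary field, and $M$ is a monomial ideal of $S$. Given a set $G$ of monomials, $m\in G$ is dominant (with respect to $G$) if there are a variable $x$ and an integer $k\ge1$ with $x^k\mid m$ and $x^k\nmid m'$ for all $m'\in G\setminus\{m\}$. A monomial ideal is 2-semidominant if its minimal generating set contains exactly two nondominant monomials. For a monomial ideal $M$ with minimal generating set $G=\{l_1,\dots,l_p\}$, the Taylor resolution $\mathbb{T}_M$ is the multigraded free resolution of $S/M$ whose free module in homological degree $j$ has basis the symbols $[l_{r_1},\dots,l_{r_j}]$, $r_1<\dots<r_j$ (one for each $j$-element subset of $G$), with $\operatorname{mdeg}[l_{r_1},\dots,l_{r_j}]=\operatorname{lcm}(l_{r_1},\dots,l_{r_j})$, and differential $f_j([l_{r_1},\dots,l_{r_j}])=\sum_{i=1}^j(-1)^{i+1}\frac{\operatorname{mdeg}[l_{r_1},\dots,l_{r_j}]}{\operatorname{mdeg}[l_{r_1},\dots,\widehat{l_{r_i}},\dots,l_{r_j}]}[l_{r_1},\dots,\widehat{l_{r_i}},\dots,l_{r_j}]$. The Scarf complex of $M$ is the subcomplex of $\mathbb{T}_M$ spanned by the basis elements $[\sigma]$ whose multidegree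 is not shared by any other basis element of $\mathbb{T}_M$. The ideal $M$ is Scarf if its Scarf complex is a minimal free resolution of $S/M$. *)

theory Defs
  imports Complex_Main "HOL-Library.Poly_Mapping"
begin

text \<open>
  Monomials are exponent vectors, written additively: the product is \<open>+\<close> and the monomial 1
  is \<open>0\<close>. The polynomial ring over \<open>'k\<close> in the variables \<open>'x\<close> is the convolution ring
  of finitely supported functions from monomials to coefficients.
\<close>

type_synonym 'x monom = "'x \<Rightarrow>\<^sub>0 nat"
type_synonym ('x, 'k) mpoly = "'x monom \<Rightarrow>\<^sub>0 'k"

abbreviation mon :: "'x monom \<Rightarrow> ('x, 'k::field) mpoly"
  where "mon s \<equiv> Poly_Mapping.single s 1"

text \<open>The order \<open>\<le>\<close> on exponent vectors in the library is lexicographic, hence a separate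
  divisibility relation.\<close>

definition mdvd :: "'x monom \<Rightarrow> 'x monom \<Rightarrow> bool"  (infix \<open>mdvd\<close> 50)
  where "s mdvd t \<longleftrightarrow> (\<exists>u. t = s + u)"

definition mlcm :: "'x::finite monom set \<Rightarrow> 'x monom"
  where "mlcm A = Abs_poly_mapping (\<lambda>x. Max (insert 0 ((\<lambda>s. Poly_Mapping.lookup s x) ` A)))"

lemma mdvd_iff: "s mdvd t \<longleftrightarrow> (\<forall>x. Poly_Mapping.lookup s x \<le> Poly_Mapping.lookup t x)"
proof
  assume "\<forall>x. Poly_Mapping.lookup s x \<le> Poly_Mapping.lookup t x"
  then have "t = s + (t - s)"
    by (intro poly_mapping_eqI) (simp add: Poly_Mapping.lookup_add Poly_Mapping.lookup_minus)
  then show "s mdvd t" unfolding mdvd_def by blast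
qed (auto simp: mdvd_def Poly_Mapping.lookup_add)

lemma lookup_mlcm: "Poly_Mapping.lookup (mlcm A) x = Max (insert 0 ((\<lambda>s. Poly_Mapping.lookup s x) ` A))"
  by (simp add: mlcm_def)

lemma mlcm_mdvd_iff:
  assumes "finite A"
  shows "mlcm A mdvd t \<longleftrightarrow> (\<forall>s\<in>A. s mdvd t)"
  using assms by (auto simp: mdvd_iff lookup_mlcm)

subsection \<open>Monomial ideals\<close>

interpretation ideal: module "(*) :: 'r::comm_ring_1 \<Rightarrow> 'r \<Rightarrow> 'r"
  by unfold_locales (simp_all add: algebra_simps)

abbreviation ideal_of :: "'r::comm_ring_1 set \<Rightarrow> 'r set"
  where "ideal_of \<equiv> module.span (*)"

definition monomial_ideal :: "('x, 'k::field) mpoly set \<Rightarrow> bool"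
  where "monomial_ideal M \<longleftrightarrow> (\<exists>G. M = ideal_of (mon ` G))"

definition minimal_generating_set :: "'x monom set \<Rightarrow> ('x, 'k::field) mpoly set \<Rightarrow> bool"
  where "minimal_generating_set G M \<longleftrightarrow>
    ideal_of (mon ` G) = M \<and> (\<forall>H. H \<subset> G \<longrightarrow> ideal_of (mon ` H) \<noteq> M)"

definition dominant :: "'x monom set \<Rightarrow> 'x monom \<Rightarrow> bool"
  where "dominant G m \<longleftrightarrow> m \<in> G \<and>
    (\<exists>x k. k \<ge> 1 \<and> Poly_Mapping.single x k mdvd m \<and>
      (\<forall>m'\<in>G - {m}. \<not> Poly_Mapping.single x k mdvd m'))"

definition two_semidominant :: "('x, 'k::field) mpoly set \<Rightarrow> bool"
  where "two_semidominant M \<longleftrightarrow> monomial_ideal M \<and>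
    (\<exists>G. minimal_generating_set G M \<and> card {m \<in> G. \<not> dominant G m} = 2)"

subsection \<open>Free resolutions of a cyclic module\<close>

text \<open>
  The free \<open>'r\<close>-module with basis \<open>B\<close> consists of the formal linear combinations of
  elements of \<open>B\<close>. A linear map out of it is given by its values on \<open>B\<close>.
\<close>

definition free_module :: "'b set \<Rightarrow> ('b \<Rightarrow>\<^sub>0 'r::comm_ring_1) set"
  where "free_module B = {u. Poly_Mapping.keys u \<subseteq> B}"

abbreviation smul :: "'r::comm_ring_1 \<Rightarrow> ('b \<Rightarrow>\<^sub>0 'r) \<Rightarrow> ('b \<Rightarrow>\<^sub>0 'r)"
  where "smul a u \<equiv> Poly_Mapping.map ((*) a) u"

definition lin_ext :: "('b \<Rightarrow> ('c \<Rightarrow>\<^sub>0 'r)) \<Rightarrow> ('b \<Rightarrow>\<^sub>0 'r::comm_ring_1) \<Rightarrow> ('c \<Rightarrow>\<^sub>0 'r)"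
  where "lin_ext f u = (\<Sum>b\<in>Poly_Mapping.keys u. smul (Poly_Mapping.lookup u b) (f b))"

definition lin_form :: "('b \<Rightarrow> 'r) \<Rightarrow> ('b \<Rightarrow>\<^sub>0 'r::comm_ring_1) \<Rightarrow> 'r"
  where "lin_form f u = (\<Sum>b\<in>Poly_Mapping.keys u. Poly_Mapping.lookup u b * f b)"

text \<open>
  Let \<open>S\<close> be the ring \<open>'r\<close> and \<open>F\<^sub>j\<close> the free module with basis \<open>B j\<close>. The values
  \<open>d j b\<close> for \<open>j \<ge> 1\<close> and \<open>b \<in> B j\<close> give the map \<open>F\<^sub>j \<rightarrow> F\<^sub>j\<^sub>-\<^sub>1\<close>, and the values
  \<open>e b\<close> for \<open>b \<in> B 0\<close>, read modulo \<open>M\<close>, give the augmentation \<open>F\<^sub>0 \<rightarrow> S/M\<close>.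
  The four conjuncts say that the maps are well defined, and that the sequence is exact at
  \<open>F\<^sub>j\<close> for \<open>j \<ge> 1\<close>, at \<open>F\<^sub>0\<close>, and at \<open>S/M\<close>.
\<close>

definition free_resolution ::
    "(nat \<Rightarrow> 'b set) \<Rightarrow> (nat \<Rightarrow> 'b \<Rightarrow> ('b \<Rightarrow>\<^sub>0 'r)) \<Rightarrow> ('b \<Rightarrow> 'r) \<Rightarrow> 'r::comm_ring_1 set \<Rightarrow> bool"
  where "free_resolution B d e M \<longleftrightarrow>
    (\<forall>j. \<forall>b\<in>B (Suc j). d (Suc j) b \<in> free_module (B j)) \<and>
    (\<forall>j. {u \<in> free_module (B (Suc j)). lin_ext (d (Suc j)) u = 0}
          = lin_ext (d (Suc (Suc j))) ` free_module (B (Suc (Suc j)))) \<and>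
    {u \<in> free_module (B 0). lin_form e u \<in> M} = lin_ext (d 1) ` free_module (B 1) \<and>
    (\<forall>s. \<exists>u\<in>free_module (B 0). s - lin_form e u \<in> M)"

definition irrelevant_ideal :: "('x, 'k::field) mpoly set"
  where "irrelevant_ideal = ideal_of ((\<lambda>x. mon (Poly_Mapping.single x 1)) ` UNIV)"

text \<open>Minimality: with \<open>\<mm>\<close> the irrelevant ideal, the image of \<open>F\<^sub>j\<^sub>+\<^sub>1\<close> lies in \<open>\<mm> F\<^sub>j\<close>,
  which consists of the elements of \<open>F\<^sub>j\<close> with all coordinates in \<open>\<mm>\<close>.\<close>

definition minimal_free_resolution ::
    "(nat \<Rightarrow> 'b set) \<Rightarrow> (nat \<Rightarrow> 'b \<Rightarrow> ('b \<Rightarrow>\<^sub>0 ('x, 'k) mpoly)) \<Rightarrow> ('b \<Rightarrow> ('x, 'k) mpoly) \<Rightarrow>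
      ('x, 'k::field) mpoly set \<Rightarrow> bool"
  where "minimal_free_resolution B d e M \<longleftrightarrow> free_resolution B d e M \<and>
    (\<forall>j. \<forall>u\<in>free_module (B (Suc j)). \<forall>c. Poly_Mapping.lookup (lin_ext (d (Suc j)) u) c \<in> irrelevant_ideal)"

subsection \<open>The Taylor resolution and the Scarf complex\<close>

text \<open>
  The list \<open>ls\<close> enumerates the minimal generating set. The symbol
  \<open>[l\<^sub>r\<^sub>1, \<dots>, l\<^sub>r\<^sub>j]\<close> is represented by the index set \<open>{r\<^sub>1, \<dots>, r\<^sub>j}\<close>, with indices
  starting at 0.
\<close>

definition taylor_symbols :: "'x monom list \<Rightarrow> nat set set"
  where "taylor_symbols ls = Pow {..<length ls}"

definition mdeg :: "'x::finite monom list \<Rightarrow> nat set \<Rightarrow> 'x monom"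
  where "mdeg ls \<sigma> = mlcm ((!) ls ` \<sigma>)"

text \<open>If \<open>r\<close> is the \<open>i\<close>-th smallest element of \<open>\<sigma>\<close>, then \<open>i - 1\<close> elements of \<open>\<sigma>\<close>
  lie below \<open>r\<close>, so the sign below is \<open>(-1)\<^sup>i\<^sup>+\<^sup>1\<close>. The subtraction is the quotient of
  monomials. The formula does not depend on the homological degree.\<close>

definition taylor_diff ::
    "'x::finite monom list \<Rightarrow> nat \<Rightarrow> nat set \<Rightarrow> (nat set \<Rightarrow>\<^sub>0 ('x, 'k::field) mpoly)"
  where "taylor_diff ls j \<sigma> =
    (\<Sum>r\<in>\<sigma>. Poly_Mapping.single (\<sigma> - {r})
       ((-1) ^ card {s \<in> \<sigma>. s < r} * mon (mdeg ls \<sigma> - mdeg ls (\<sigma> - {r}))))"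

definition scarf_basis :: "'x::finite monom list \<Rightarrow> nat \<Rightarrow> nat set set"
  where "scarf_basis ls j = {\<sigma> \<in> taylor_symbols ls. card \<sigma> = j \<and>
    (\<forall>\<tau>\<in>taylor_symbols ls. mdeg ls \<tau> = mdeg ls \<sigma> \<longrightarrow> \<tau> = \<sigma>)}"

text \<open>The augmentation sends the symbol \<open>[]\<close>, the only possible one in degree 0, to the class
  of 1.\<close>

definition scarf :: "'x::finite monom list \<Rightarrow> ('x, 'k::field) mpoly set \<Rightarrow> bool"
  where "scarf ls M \<longleftrightarrow>
    minimal_free_resolution (scarf_basis ls) (taylor_diff ls) (\<lambda>_. 1) M"

definition basis_of_mdeg :: "'x::finite monom list \<Rightarrow> 'x monom \<Rightarrow> nat set set"
  where "basis_of_mdeg ls m = {\<sigma> \<in> taylor_symbols ls. mdeg ls \<sigma> = m}"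

definition shared_mdegs :: "'x::finite monom list \<Rightarrow> 'x monom set"
  where "shared_mdegs ls = {m. card (basis_of_mdeg ls m) > 1}"

end

theory Submission
  imports Defs
begin

text \<open>
  Let \<open>a\<close>, \<open>b\<close> be the two nondominant generators. A dominant generator divides the lcm of a set
  \<open>\<sigma>\<close> of generators only if it belongs to \<open>\<sigma>\<close> (\<open>dominant_mdvd_mdeg\<close>). So two symbols of the
  same multidegree agree outside \<open>a\<close>, \<open>b\<close>, and each \<open>B\<^sub>m\<close> consists of some of the four sets
  \<open>\<tau>\<close>, \<open>\<tau> \<union> {a}\<close>, \<open>\<tau> \<union> {b}\<close>, \<open>\<tau> \<union> {a, b}\<close>, where \<open>\<tau>\<close> omits \<open>a\<close> and \<open>b\<close>. Multidegrees grow
  with the set and turn unions into lcms; hence the only odd cardinality above 1 is 3, attained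
  when the last three sets share a multidegree that is not the one of \<open>\<tau>\<close>. Such a \<open>\<tau>\<close> is called
  a clash. Both sides of the equivalence say that there is no clash
  (\<open>even_card_iff_no_clash\<close>, \<open>scarf_iff_no_clash\<close>).

  The Scarf complex is compared with simplicial complexes one multidegree \<open>t\<close> at a time. In
  degree \<open>t\<close> it is the chain complex over the field of \<open>scarf_faces ls t\<close>, the set of
  Scarf symbols with multidegree dividing \<open>t\<close>, which is closed under subsets. So the ideal is Scarf
  once these complexes are acyclic for all monomials \<open>t\<close> in the ideal (\<open>scarf_if_acyclic\<close>), and
  for a Scarf ideal their cycles in positive degree bound (\<open>scarf_imp_exact\<close>).

  In these terms a symbol \<open>\<sigma>\<close> is Scarf iff neither \<open>a\<close> divides the lcm of \<open>\<sigma> - {a}\<close> nor \<open>b\<close> that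
  of \<open>\<sigma> - {b}\<close>. If at most one of \<open>a\<close>, \<open>b\<close> divides \<open>t\<close>, the complex is a cone. If both divide
  \<open>t\<close> and there is no clash, it is the union of the stars of \<open>a\<close> and \<open>b\<close>, two cones whose
  intersection is again a cone, and Mayer--Vietoris gives acyclicity.

  Conversely let \<open>\<tau>\<close> be a clash of least cardinality and \<open>t\<close> the lcm of \<open>\<tau> \<union> {a, b}\<close>. All proper
  subsets of \<open>\<tau>\<close> lie in the union of the two stars, which is acyclic, so the boundary of \<open>\<tau>\<close> is
  also the boundary of a chain \<open>w\<close> in that union. The cycle \<open>\<tau> - w\<close> does not bound: it has
  coefficient 1 at \<open>\<tau>\<close>, which is a proper face of no face of the complex in degree \<open>t\<close>.
\<close>

section \<open>Chains on sets of indices\<close>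

text \<open>
  The sign in front of the face \<open>A - {r}\<close> (or, read upwards, of the coface \<open>insert r A\<close>): it
  depends only on the elements below \<open>r\<close>, so it is the same for \<open>A\<close> with or without \<open>r\<close>.
\<close>

definition psign :: "nat set \<Rightarrow> nat \<Rightarrow> 'k::comm_ring_1"
  where "psign A r = (-1) ^ card {s \<in> A. s < r}"

text \<open>
  The simplicial boundary, given by its coefficients: a chain is a function on index sets, and the
  coefficient of the boundary at \<open>\<rho>\<close> collects the cofaces \<open>insert r \<rho>\<close>. This is the shape in
  which the Taylor differential appears in a fixed multidegree.
\<close>

definition bdry :: "nat \<Rightarrow> (nat set \<Rightarrow> 'k::comm_ring_1) \<Rightarrow> nat set \<Rightarrow> 'k"
  where "bdry n c \<rho> = (\<Sum>r\<in>{..<n} - \<rho>. psign \<rho> r * c (insert r \<rho>))"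

definition supported_on :: "nat set set \<Rightarrow> (nat set \<Rightarrow> 'k::comm_ring_1) \<Rightarrow> bool"
  where "supported_on K c \<longleftrightarrow> (\<forall>\<sigma>. \<sigma> \<notin> K \<longrightarrow> c \<sigma> = 0)"

definition subset_closed :: "nat set set \<Rightarrow> bool"
  where "subset_closed K \<longleftrightarrow> (\<forall>\<sigma>\<in>K. \<forall>\<rho>. \<rho> \<subseteq> \<sigma> \<longrightarrow> \<rho> \<in> K)"

text \<open>
  All cycles bound, the empty set counting as a face of degree 0; this is the vanishing of reduced
  homology, over a coefficient ring that only the type argument records.
\<close>

definition acyclic_complex :: "'k::comm_ring_1 itself \<Rightarrow> nat \<Rightarrow> nat set set \<Rightarrow> bool"
  where "acyclic_complex _ n K \<longleftrightarrow>
    (\<forall>c :: nat set \<Rightarrow> 'k. supported_on K c \<and> bdry n c = (\<lambda>_. 0) \<longrightarrow>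
      (\<exists>w. supported_on K w \<and> bdry n w = c))"

text \<open>
  The join with the vertex \<open>i\<close>. It is a contracting homotopy wherever adding \<open>i\<close> is
  allowed.
\<close>

definition cone :: "nat \<Rightarrow> (nat set \<Rightarrow> 'k::comm_ring_1) \<Rightarrow> nat set \<Rightarrow> 'k"
  where "cone i c \<sigma> = (if i \<in> \<sigma> then psign \<sigma> i * c (\<sigma> - {i}) else 0)"

lemma supported_onD: "supported_on K c \<Longrightarrow> \<sigma> \<notin> K \<Longrightarrow> c \<sigma> = 0"
  by (simp add: supported_on_def)

lemma subset_closedD: "subset_closed K \<Longrightarrow> \<sigma> \<in> K \<Longrightarrow> \<rho> \<subseteq> \<sigma> \<Longrightarrow> \<rho> \<in> K"
  by (auto simp: subset_closed_def)

lemma bdry_add: "bdry n (\<lambda>\<sigma>. c \<sigma> + d \<sigma>) \<rho> = bdry n c \<rho> + bdry n d \<rho>"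
  by (simp add: bdry_def algebra_simps sum.distrib)

lemma bdry_diff: "bdry n (\<lambda>\<sigma>. c \<sigma> - d \<sigma>) \<rho> = bdry n c \<rho> - bdry n d \<rho>"
  by (simp add: bdry_def algebra_simps sum_subtractf)

lemma bdry_zero: "bdry n (\<lambda>_. 0) = (\<lambda>_. 0)"
  by (simp add: bdry_def fun_eq_iff)

lemma bdry_supported:
  assumes "subset_closed K" "supported_on K c"
  shows "supported_on K (bdry n c)"
  unfolding supported_on_def
proof (intro allI impI)
  fix \<rho> assume "\<rho> \<notin> K"
  then have "c (insert r \<rho>) = 0" for r
    using assms unfolding supported_on_def subset_closed_def by (metis subset_insertI)
  then show "bdry n c \<rho> = 0" by (simp add: bdry_def)
qed

lemma psign_insert:
  assumes "finite \<rho>" "q \<notin> \<rho>"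
  shows "psign (insert q \<rho>) r = (if q < r then - psign \<rho> r else psign \<rho> r)"
proof (cases "q < r")
  case True
  then have "{s \<in> insert q \<rho>. s < r} = insert q {s \<in> \<rho>. s < r}" by auto
  then show ?thesis using True assms by (simp add: psign_def)
next
  case False
  then have "{s \<in> insert q \<rho>. s < r} = {s \<in> \<rho>. s < r}" by auto
  then show ?thesis using False by (simp add: psign_def)
qed

lemma psign_square: "psign A r * psign A r = 1" "psign A r * (psign A r * x) = x"
proof -
  show 1: "psign A r * psign A r = 1" for A r
    unfolding psign_def by (simp add: power_mult_distrib[symmetric])
  show "psign A r * (psign A r * x) = x" by (simp add: mult.assoc[symmetric] 1)
qed

text \<open>
  Removing two vertices in the two possible orders gives opposite signs, since one of the two
  removals shifts the position of the other vertex by one.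
\<close>

lemma psign_swap:
  assumes "finite \<rho>" "q \<notin> \<rho>" "r \<notin> \<rho>" "r \<noteq> q"
  shows "psign \<rho> r * psign (insert r \<rho>) q = - (psign \<rho> q * psign (insert q \<rho>) r)"
  using assms by (cases "q < r") (auto simp: psign_insert mult.commute)

text \<open>
  Characteristic 2 is covered: the two terms of each unordered pair cancel, and the sum is never
  compared with its own negative.
\<close>

lemma sum_antisymmetric:
  fixes f :: "'a \<Rightarrow> 'a \<Rightarrow> 'k::comm_ring_1"
  assumes "finite R" "\<And>r q. r \<in> R \<Longrightarrow> q \<in> R \<Longrightarrow> r \<noteq> q \<Longrightarrow> f r q = - f q r"
  shows "(\<Sum>r\<in>R. \<Sum>q\<in>R - {r}. f r q) = 0"
  using assms
proof (induction R rule: finite_induct)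
  case empty
  then show ?case by simp
next
  case (insert x R)
  have "(\<Sum>q\<in>insert x R - {r}. f r q) = f r x + (\<Sum>q\<in>R - {r}. f r q)" if "r \<in> R" for r
  proof -
    have "insert x R - {r} = insert x (R - {r})" using that insert.hyps by auto
    then show ?thesis using insert.hyps by simp
  qed
  moreover have "(\<Sum>r\<in>R. \<Sum>q\<in>R - {r}. f r q) = 0"
    by (rule insert.IH) (rule insert.prems, auto)
  ultimately have "(\<Sum>r\<in>R. \<Sum>q\<in>insert x R - {r}. f r q) = (\<Sum>r\<in>R. f r x)"
    by (simp add: sum.distrib)
  moreover have "insert x R - {x} = R" using insert.hyps by auto
  moreover have "(\<Sum>q\<in>R. f x q) = - (\<Sum>r\<in>R. f r x)"
    unfolding sum_negf[symmetric]
    by (intro sum.cong refl insert.prems) (use insert.hyps in auto)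
  ultimately show ?case using insert.hyps by simp
qed

lemma supported_on_infinite:
  assumes "supported_on (Pow {..<n}) c" "infinite \<rho>"
  shows "c \<rho> = 0"
proof -
  have "\<rho> \<notin> Pow {..<n}" using assms(2) by (auto dest: finite_subset[of _ "{..<n}"])
  then show ?thesis using assms(1) by (rule supported_onD[rotated])
qed

lemma bdry_bdry:
  assumes "supported_on (Pow {..<n}) c"
  shows "bdry n (bdry n c) = (\<lambda>_. 0)"
proof
  fix \<rho>
  show "bdry n (bdry n c) \<rho> = 0"
  proof (cases "finite \<rho>")
    case True
    define R where "R = {..<n} - \<rho>"
    define f where "f r q = psign \<rho> r * psign (insert r \<rho>) q * c (insert q (insert r \<rho>))" for r q
    have swap: "f r q = - f q r" if "r \<in> R" "q \<in> R" "r \<noteq> q" for r q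
      using that psign_swap[where ?'a = 'a, OF True, of q r] by (simp add: f_def R_def insert_commute)
    have "(\<Sum>r\<in>R. \<Sum>q\<in>R - {r}. f r q) = 0"
      by (rule sum_antisymmetric[OF _ swap]) (simp_all add: R_def)
    moreover have R: "{..<n} - insert r \<rho> = R - {r}" for r by (auto simp: R_def)
    ultimately show ?thesis
      by (simp only: bdry_def f_def R R_def[symmetric] sum_distrib_left mult.assoc)
  next
    case False
    then have "c (insert q (insert r \<rho>)) = 0" for q r
      by (intro supported_on_infinite[OF assms]) simp
    then show ?thesis by (simp add: bdry_def)
  qed
qed

lemma cone_homotopy:
  assumes "finite \<sigma>" "i < n"
  shows "bdry n (cone i c) \<sigma> + cone i (bdry n c) \<sigma> = c \<sigma>"
proof (cases "i \<in> \<sigma>")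
  case False
  have "psign \<sigma> r * cone i c (insert r \<sigma>) = (if r = i then c \<sigma> else 0)" for r
    using False assms by (auto simp: cone_def psign_insert psign_square)
  then show ?thesis using False assms by (simp add: bdry_def cone_def)
next
  case True
  define \<rho> where "\<rho> = \<sigma> - {i}"
  have \<sigma>: "\<sigma> = insert i \<rho>" and i: "i \<notin> \<rho>" and fin: "finite \<rho>"
    using True assms by (auto simp: \<rho>_def)
  let ?R = "{..<n} - \<sigma>"
  let ?S = "\<Sum>r\<in>?R. psign \<rho> i * (psign \<rho> r * c (insert r \<rho>))"
  have R: "{..<n} - \<rho> = insert i ?R" using \<open>i < n\<close> by (auto simp: \<sigma> i)
  have "psign \<sigma> i = (psign \<rho> i :: 'a)" using i fin by (simp add: \<sigma> psign_insert)
  moreover have "bdry n c \<rho> = psign \<rho> i * c \<sigma> + (\<Sum>r\<in>?R. psign \<rho> r * c (insert r \<rho>))"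
    unfolding bdry_def R by (simp add: \<sigma>)
  ultimately have 1: "cone i (bdry n c) \<sigma> = c \<sigma> + ?S"
    using True by (simp add: cone_def \<rho>_def[symmetric] distrib_left sum_distrib_left psign_square)
  have "psign \<sigma> r * cone i c (insert r \<sigma>) = - (psign \<rho> i * (psign \<rho> r * c (insert r \<rho>)))"
    if r: "r \<in> ?R" for r
  proof -
    have "insert r \<sigma> - {i} = insert r \<rho>" using r i by (auto simp: \<sigma>)
    then have "cone i c (insert r \<sigma>) = psign (insert r \<sigma>) i * c (insert r \<rho>)"
      by (simp add: cone_def \<sigma>)
    moreover have "psign \<sigma> r * psign (insert r \<sigma>) i = - (psign \<rho> i * psign \<rho> r :: 'a)"
      using r i fin by (cases "r < i") (auto simp: \<sigma> psign_insert mult.commute)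
    ultimately show ?thesis by (simp only: mult.assoc[symmetric] mult_minus_left)
  qed
  then have "bdry n (cone i c) \<sigma> = - ?S" by (simp add: bdry_def sum_negf)
  then show ?thesis using 1 by simp
qed

lemma acyclic_cone:
  assumes K: "K \<subseteq> Pow {..<n}" "subset_closed K" and i: "i < n"
    and apex: "\<And>\<sigma>. \<sigma> \<in> K \<Longrightarrow> insert i \<sigma> \<in> K"
  shows "acyclic_complex TYPE('k::comm_ring_1) n K"
  unfolding acyclic_complex_def
proof (intro allI impI, elim conjE)
  fix c :: "nat set \<Rightarrow> 'k" assume c: "supported_on K c" "bdry n c = (\<lambda>_. 0)"
  have supp: "supported_on K (cone i c)"
    unfolding supported_on_def
  proof (intro allI impI)
    fix \<sigma> assume "\<sigma> \<notin> K"
    then have "\<sigma> - {i} \<notin> K" if "i \<in> \<sigma>" using apex[of "\<sigma> - {i}"] that by (auto simp: insert_absorb)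
    then show "cone i c \<sigma> = 0" using supported_onD[OF c(1)] by (simp add: cone_def)
  qed
  have "bdry n (cone i c) \<sigma> = c \<sigma>" for \<sigma>
  proof (cases "\<sigma> \<in> K")
    case True
    then have "finite \<sigma>" using K by (auto intro: finite_subset)
    then have "bdry n (cone i c) \<sigma> + cone i (bdry n c) \<sigma> = c \<sigma>" using i by (rule cone_homotopy)
    then show ?thesis by (simp add: c(2) cone_def split: if_splits)
  next
    case False
    then show ?thesis using supported_onD[OF c(1)] supported_onD[OF bdry_supported[OF K(2) supp, of n]] by simp
  qed
  then show "\<exists>w. supported_on K w \<and> bdry n w = c" using supp by blast
qed

text \<open>
  The Mayer--Vietoris argument. Split a cycle into a part in \<open>K1\<close> and a part in \<open>K2\<close>. Their
  boundaries are opposite, so they lie in the intersection and bound a chain \<open>x\<close> there; moving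
  \<open>x\<close> from one part to the other makes both parts cycles.
\<close>

lemma acyclic_union:
  assumes K: "subset_closed K1" "subset_closed K2" "K1 \<subseteq> Pow {..<n}"
    and acyclic: "acyclic_complex TYPE('k::comm_ring_1) n K1" "acyclic_complex TYPE('k) n K2"
      "acyclic_complex TYPE('k) n (K1 \<inter> K2)"
  shows "acyclic_complex TYPE('k) n (K1 \<union> K2)"
  unfolding acyclic_complex_def
proof (intro allI impI, elim conjE)
  fix c :: "nat set \<Rightarrow> 'k" assume c: "supported_on (K1 \<union> K2) c" "bdry n c = (\<lambda>_. 0)"
  define c1 where "c1 = (\<lambda>\<sigma>. if \<sigma> \<in> K1 then c \<sigma> else 0)"
  define c2 where "c2 = (\<lambda>\<sigma>. c \<sigma> - c1 \<sigma>)"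
  have s1: "supported_on K1 c1" and s2: "supported_on K2 c2"
    using c by (auto simp: supported_on_def c1_def c2_def)
  define y where "y = bdry n c1"
  have c2y: "bdry n c2 = (\<lambda>\<rho>. - y \<rho>)"
    by (rule ext) (simp add: c2_def bdry_diff y_def c(2))
  have "supported_on K1 y" unfolding y_def by (rule bdry_supported[OF K(1) s1])
  moreover have "supported_on K2 (\<lambda>\<rho>. - y \<rho>)" unfolding c2y[symmetric] by (rule bdry_supported[OF K(2) s2])
  ultimately have "supported_on (K1 \<inter> K2) y" by (auto simp: supported_on_def)
  moreover have "bdry n y = (\<lambda>_. 0)" unfolding y_def
    by (rule bdry_bdry) (use s1 K(3) in \<open>auto simp: supported_on_def\<close>)
  ultimately obtain x where x: "supported_on (K1 \<inter> K2) x" "bdry n x = y"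
    using acyclic(3) unfolding acyclic_complex_def by blast
  have "supported_on K1 (\<lambda>\<sigma>. c1 \<sigma> - x \<sigma>)" using s1 x by (auto simp: supported_on_def)
  moreover have "bdry n (\<lambda>\<sigma>. c1 \<sigma> - x \<sigma>) = (\<lambda>_. 0)" by (rule ext) (simp add: bdry_diff x y_def)
  ultimately obtain w1 where w1: "supported_on K1 w1" "bdry n w1 = (\<lambda>\<sigma>. c1 \<sigma> - x \<sigma>)"
    using acyclic(1) unfolding acyclic_complex_def by blast
  have "supported_on K2 (\<lambda>\<sigma>. c2 \<sigma> + x \<sigma>)" using s2 x by (auto simp: supported_on_def)
  moreover have "bdry n (\<lambda>\<sigma>. c2 \<sigma> + x \<sigma>) = (\<lambda>_. 0)" by (rule ext) (simp add: bdry_add x c2y)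
  ultimately obtain w2 where w2: "supported_on K2 w2" "bdry n w2 = (\<lambda>\<sigma>. c2 \<sigma> + x \<sigma>)"
    using acyclic(2) unfolding acyclic_complex_def by blast
  have "supported_on (K1 \<union> K2) (\<lambda>\<sigma>. w1 \<sigma> + w2 \<sigma>)" using w1 w2 by (auto simp: supported_on_def)
  moreover have "bdry n (\<lambda>\<sigma>. w1 \<sigma> + w2 \<sigma>) = c"
    by (rule ext) (simp add: bdry_add w1 w2 c2_def)
  ultimately show "\<exists>w. supported_on (K1 \<union> K2) w \<and> bdry n w = c" by blast
qed

text \<open>
  The boundary lowers cardinality by one, so a preimage of a homogeneous chain can be made
  homogeneous by truncation.
\<close>

lemma bdry_restrict_card:
  assumes "supported_on (Pow {..<n}) w"
  shows "bdry n (\<lambda>\<sigma>. if card \<sigma> = Suc j then w \<sigma> else 0) \<rho> = (if card \<rho> = j then bdry n w \<rho> else 0)"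
proof (cases "finite \<rho>")
  case True
  then have "card (insert r \<rho>) = Suc j \<longleftrightarrow> card \<rho> = j" if "r \<in> {..<n} - \<rho>" for r
    using that by simp
  then have "bdry n (\<lambda>\<sigma>. if card \<sigma> = Suc j then w \<sigma> else 0) \<rho>
      = (\<Sum>r\<in>{..<n} - \<rho>. if card \<rho> = j then psign \<rho> r * w (insert r \<rho>) else 0)"
    unfolding bdry_def by (intro sum.cong) simp_all
  then show ?thesis by (simp add: bdry_def)
next
  case False
  then have "w (insert r \<rho>) = 0" for r
    by (intro supported_on_infinite[OF assms]) simp
  then show ?thesis by (simp add: bdry_def cong: if_cong)
qed

section \<open>Monomial ideals\<close>

lemma mdvd_refl: "s mdvd s" by (simp add: mdvd_iff)

lemma mdvd_trans: "s mdvd t \<Longrightarrow> t mdvd u \<Longrightarrow> s mdvd u"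
  by (meson mdvd_iff le_trans)

lemma mdvd_antisym: "s mdvd t \<Longrightarrow> t mdvd s \<Longrightarrow> s = t"
  by (intro poly_mapping_eqI) (simp add: mdvd_iff le_antisym)

lemma mdvd_zero: "0 mdvd t" by (simp add: mdvd_iff)

lemma sum_monomials:
  "p = (\<Sum>t\<in>Poly_Mapping.keys p. Poly_Mapping.single t (Poly_Mapping.lookup p t))"
  by (intro poly_mapping_eqI) (auto simp: lookup_sum lookup_single when_def in_keys_iff)

text \<open>
  A combination of monomials of \<open>G\<close> has only terms divisible by one of them; conversely a
  polynomial with such terms is the sum of its terms, each of which lies in the ideal.
\<close>

lemma mem_ideal_of_monomials:
  fixes p :: "('x, 'k::field) mpoly"
  shows "p \<in> ideal_of (mon ` G) \<longleftrightarrow> (\<forall>t\<in>Poly_Mapping.keys p. \<exists>g\<in>G. g mdvd t)"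
proof
  assume "p \<in> ideal_of (mon ` G)"
  then show "\<forall>t\<in>Poly_Mapping.keys p. \<exists>g\<in>G. g mdvd t"
  proof (induction rule: ideal.span_induct_alt)
    case base
    then show ?case by simp
  next
    case (step c x y)
    from step.hyps obtain g where g: "g \<in> G" "x = mon g" by blast
    show ?case
    proof
      fix t assume "t \<in> Poly_Mapping.keys (c * x + y)"
      then consider "t \<in> Poly_Mapping.keys (c * x)" | "t \<in> Poly_Mapping.keys y"
        using keys_add[of "c * x" y] by blast
      then show "\<exists>g\<in>G. g mdvd t"
      proof cases
        case 1
        then obtain a where "t = a + g" using keys_mult[of c x] g by (auto split: if_splits)
        then have "g mdvd t" by (auto simp: mdvd_def add.commute)
        then show ?thesis using g by blast
      qed (use step in blast)
    qed
  qed
next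
  assume *: "\<forall>t\<in>Poly_Mapping.keys p. \<exists>g\<in>G. g mdvd t"
  have "(\<Sum>t\<in>Poly_Mapping.keys p. Poly_Mapping.single t (Poly_Mapping.lookup p t)) \<in> ideal_of (mon ` G)"
  proof (rule ideal.span_sum)
    fix t assume "t \<in> Poly_Mapping.keys p"
    then obtain g u where g: "g \<in> G" "t = g + u" using * unfolding mdvd_def by blast
    have "Poly_Mapping.single t (Poly_Mapping.lookup p t)
        = Poly_Mapping.single u (Poly_Mapping.lookup p t) * mon g"
      by (simp add: mult_single g add.commute)
    then show "Poly_Mapping.single t (Poly_Mapping.lookup p t) \<in> ideal_of (mon ` G)"
      using g(1) by (simp add: ideal.span_scale ideal.span_base)
  qed
  then show "p \<in> ideal_of (mon ` G)" using sum_monomials[of p] by simp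
qed

lemma mon_mem_ideal_of_monomials:
  "(mon t :: ('x, 'k::field) mpoly) \<in> ideal_of (mon ` G) \<longleftrightarrow> (\<exists>g\<in>G. g mdvd t)"
  by (simp add: mem_ideal_of_monomials)

lemma minimal_generators_antichain:
  fixes M :: "('x, 'k::field) mpoly set"
  assumes G: "minimal_generating_set G M" and "g \<in> G" "h \<in> G" "g mdvd h"
  shows "g = h"
proof (rule ccontr)
  assume "g \<noteq> h"
  have "\<exists>g'\<in>G - {h}. g' mdvd t" if "g' \<in> G" "g' mdvd t" for g' t
    using that assms \<open>g \<noteq> h\<close> mdvd_trans by (cases "g' = h") blast+
  then have "ideal_of (mon ` (G - {h})) = (ideal_of (mon ` G) :: ('x, 'k) mpoly set)"
    by (intro set_eqI) (auto simp: mem_ideal_of_monomials; meson DiffD1)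
  then show False using G \<open>h \<in> G\<close> unfolding minimal_generating_set_def by blast
qed

lemma minimal_generators_subset:
  fixes M :: "('x, 'k::field) mpoly set"
  assumes G: "minimal_generating_set G M" and H: "minimal_generating_set H M"
  shows "G \<subseteq> H"
proof
  fix g assume g: "g \<in> G"
  have M: "ideal_of (mon ` G) = M" "ideal_of (mon ` H) = M"
    using G H by (auto simp: minimal_generating_set_def)
  have gh: "(\<exists>g\<in>G. g mdvd t) \<longleftrightarrow> (\<exists>h\<in>H. h mdvd t)" for t
    using mon_mem_ideal_of_monomials[of t G, where ?'k = 'k]
      mon_mem_ideal_of_monomials[of t H, where ?'k = 'k] M by simp
  from gh[of g] g mdvd_refl obtain h where h: "h \<in> H" "h mdvd g" by blast
  from gh[of h] h mdvd_refl obtain g' where g': "g' \<in> G" "g' mdvd h" by blast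
  have "g' = g" using minimal_generators_antichain[OF G g'(1) g] g' h mdvd_trans by blast
  then show "g \<in> H" using h g' mdvd_antisym by blast
qed

text \<open>
  This identifies the generating set that witnesses 2-semidominance with the given
  enumeration.
\<close>

lemma minimal_generators_unique:
  "minimal_generating_set G M \<Longrightarrow> minimal_generating_set H M \<Longrightarrow> G = H"
  by (intro equalityI minimal_generators_subset)

lemma lookup_mult_mon:
  fixes p :: "('x, 'k::field) mpoly"
  shows "Poly_Mapping.lookup (p * mon v) s = (if v mdvd s then Poly_Mapping.lookup p (s - v) else 0)"
proof -
  have eq: "s = t + v \<longleftrightarrow> v mdvd s \<and> s - v = t" for t
    by (auto simp: mdvd_def add.commute)
  have "p * mon v = (\<Sum>t\<in>Poly_Mapping.keys p. Poly_Mapping.single (t + v) (Poly_Mapping.lookup p t))"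
    by (subst sum_monomials[of p]) (simp add: sum_distrib_right mult_single)
  then have "Poly_Mapping.lookup (p * mon v) s
      = (\<Sum>t\<in>Poly_Mapping.keys p. if v mdvd s \<and> s - v = t then Poly_Mapping.lookup p t else 0)"
    by (simp add: lookup_sum lookup_single when_def eq eq_commute[of _ s])
  then show ?thesis by (auto simp: in_keys_iff)
qed

lemma lookup_minus_one_power_mult:
  fixes p :: "('x, 'k::field) mpoly"
  shows "Poly_Mapping.lookup ((-1) ^ k * p) s = (-1) ^ k * Poly_Mapping.lookup p s"
  by (cases "even k") simp_all

text \<open>
  Every monomial other than 1 is divisible by a variable.
\<close>

lemma mem_irrelevant_ideal:
  fixes p :: "('x, 'k::field) mpoly"
  assumes "Poly_Mapping.lookup p 0 = 0"
  shows "p \<in> irrelevant_ideal"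
proof -
  have "\<exists>x. Poly_Mapping.single x 1 mdvd t" if "t \<in> Poly_Mapping.keys p" for t
  proof -
    have "t \<noteq> 0" using that assms by (auto simp: in_keys_iff)
    then obtain x where "Poly_Mapping.lookup t x \<noteq> 0" by (metis lookup_zero poly_mapping_eqI)
    then have "Poly_Mapping.single x 1 mdvd t" by (auto simp: mdvd_iff lookup_single when_def)
    then show ?thesis ..
  qed
  then have "p \<in> ideal_of (mon ` range (\<lambda>x. Poly_Mapping.single x 1))"
    by (simp add: mem_ideal_of_monomials)
  then show ?thesis by (simp add: irrelevant_ideal_def image_image)
qed

section \<open>The Taylor differential in a single multidegree\<close>

lemma mdeg_mdvd_iff:
  "finite \<sigma> \<Longrightarrow> mdeg ls \<sigma> mdvd t \<longleftrightarrow> (\<forall>i\<in>\<sigma>. ls ! i mdvd t)"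
  by (simp add: mdeg_def mlcm_mdvd_iff)

lemma generator_mdvd_mdeg: "finite \<sigma> \<Longrightarrow> i \<in> \<sigma> \<Longrightarrow> ls ! i mdvd mdeg ls \<sigma>"
  using mdeg_mdvd_iff mdvd_refl by blast

lemma mdeg_mono: "finite \<sigma> \<Longrightarrow> \<rho> \<subseteq> \<sigma> \<Longrightarrow> mdeg ls \<rho> mdvd mdeg ls \<sigma>"
  by (auto simp: mdeg_mdvd_iff finite_subset intro: generator_mdvd_mdeg)

lemma mdeg_insert:
  assumes "finite \<sigma>"
  shows "mdeg ls (insert i \<sigma>) = mdeg ls \<sigma> \<longleftrightarrow> ls ! i mdvd mdeg ls \<sigma>"
proof
  assume "mdeg ls (insert i \<sigma>) = mdeg ls \<sigma>"
  then show "ls ! i mdvd mdeg ls \<sigma>"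
    using assms by (metis finite_insert generator_mdvd_mdeg insertI1)
next
  assume "ls ! i mdvd mdeg ls \<sigma>"
  then have "mdeg ls (insert i \<sigma>) mdvd mdeg ls \<sigma>"
    using assms by (simp add: mdeg_mdvd_iff generator_mdvd_mdeg)
  then show "mdeg ls (insert i \<sigma>) = mdeg ls \<sigma>"
    using mdvd_antisym mdeg_mono[of "insert i \<sigma>" \<sigma> ls] assms by blast
qed

lemma mdeg_empty: "mdeg ls {} = 0"
  by (intro poly_mapping_eqI) (simp add: mdeg_def lookup_mlcm)

text \<open>
  The part of multidegree \<open>t\<close> of an element of the free module, as a chain over the field: the
  symbol \<open>\<sigma>\<close> itself has multidegree \<open>mdeg ls \<sigma>\<close>, so only its multiple by the monomial
  \<open>t - mdeg ls \<sigma>\<close> contributes, with value 0 if this quotient does not exist.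
\<close>

definition strand ::
    "'x::finite monom list \<Rightarrow> 'x monom \<Rightarrow> (nat set \<Rightarrow>\<^sub>0 ('x, 'k::field) mpoly) \<Rightarrow> nat set \<Rightarrow> 'k"
  where "strand ls t u \<sigma> =
    (if mdeg ls \<sigma> mdvd t then Poly_Mapping.lookup (Poly_Mapping.lookup u \<sigma>) (t - mdeg ls \<sigma>) else 0)"

lemma lookup_eq_strand:
  "Poly_Mapping.lookup (Poly_Mapping.lookup u \<sigma>) s = strand ls (s + mdeg ls \<sigma>) u \<sigma>"
  by (simp add: strand_def mdvd_iff lookup_add)

lemma strand_eqI:
  assumes "\<And>t. strand ls t u = strand ls t v"
  shows "u = v"
  by (intro poly_mapping_eqI) (simp only: lookup_eq_strand[where ls = ls] assms)

lemma strand_zero: "strand ls t 0 = (\<lambda>_. 0)"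
  by (simp add: strand_def fun_eq_iff)

lemma strand_sum: "strand ls t (\<Sum>i\<in>A. f i) \<sigma> = (\<Sum>i\<in>A. strand ls t (f i) \<sigma>)"
  by (simp add: strand_def lookup_sum)

lemma finite_strands: "finite {t. strand ls t u \<noteq> (\<lambda>_. 0)}"
proof (rule finite_subset)
  show "{t. strand ls t u \<noteq> (\<lambda>_. 0)} \<subseteq> (\<Union>\<sigma>\<in>Poly_Mapping.keys u.
      (\<lambda>s. s + mdeg ls \<sigma>) ` Poly_Mapping.keys (Poly_Mapping.lookup u \<sigma>))"
  proof
    fix t assume "t \<in> {t. strand ls t u \<noteq> (\<lambda>_. 0)}"
    then obtain \<sigma> where *: "mdeg ls \<sigma> mdvd t"
        "Poly_Mapping.lookup (Poly_Mapping.lookup u \<sigma>) (t - mdeg ls \<sigma>) \<noteq> 0"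
      by (auto simp: strand_def fun_eq_iff split: if_splits)
    moreover from *(1) have "t = (t - mdeg ls \<sigma>) + mdeg ls \<sigma>"
      by (auto simp: mdvd_def add.commute)
    ultimately show "t \<in> (\<Union>\<sigma>\<in>Poly_Mapping.keys u.
      (\<lambda>s. s + mdeg ls \<sigma>) ` Poly_Mapping.keys (Poly_Mapping.lookup u \<sigma>))"
      by (intro UN_I[of \<sigma>] image_eqI[of _ _ "t - mdeg ls \<sigma>"]) (auto simp: in_keys_iff)
  qed
qed simp

lemma strand_monomial_term:
  "strand ls t' (Poly_Mapping.single \<sigma> (Poly_Mapping.single (t - mdeg ls \<sigma>) c)) \<rho>
    = (if \<rho> = \<sigma> \<and> mdeg ls \<sigma> mdvd t' \<and> t' - mdeg ls \<sigma> = t - mdeg ls \<sigma> then c else 0)"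
  by (auto simp: strand_def lookup_single when_def)

text \<open>
  The inverse construction: the element whose only nonzero strand is the chain \<open>c\<close> in
  multidegree \<open>t\<close>.
\<close>

definition homogeneous_element ::
    "'x::finite monom list \<Rightarrow> 'x monom \<Rightarrow> (nat set \<Rightarrow> 'k) \<Rightarrow> (nat set \<Rightarrow>\<^sub>0 ('x, 'k::field) mpoly)"
  where "homogeneous_element ls t c =
    (\<Sum>\<sigma>\<in>Pow {..<length ls}. Poly_Mapping.single \<sigma> (Poly_Mapping.single (t - mdeg ls \<sigma>) (c \<sigma>)))"

lemma strand_homogeneous_element:
  assumes "supported_on {\<sigma> \<in> Pow {..<length ls}. mdeg ls \<sigma> mdvd t} c"
  shows "strand ls t' (homogeneous_element ls t c) = (if t' = t then c else (\<lambda>_. 0))"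
proof
  fix \<rho>
  have "t' = t" if "mdeg ls \<rho> mdvd t'" "t' - mdeg ls \<rho> = t - mdeg ls \<rho>" "mdeg ls \<rho> mdvd t"
    using that by (auto simp: mdvd_def)
  then have "(if \<rho> \<in> Pow {..<length ls} \<and> mdeg ls \<rho> mdvd t' \<and> t' - mdeg ls \<rho> = t - mdeg ls \<rho>
      then c \<rho> else 0) = (if t' = t then c \<rho> else 0)"
    using supported_onD[OF assms, of \<rho>] by (cases "c \<rho> = 0") auto
  moreover have "strand ls t' (homogeneous_element ls t c) \<rho>
    = (\<Sum>\<sigma>\<in>Pow {..<length ls}. if \<rho> = \<sigma> then
      (if mdeg ls \<rho> mdvd t' \<and> t' - mdeg ls \<rho> = t - mdeg ls \<rho> then c \<rho> else 0) else 0)"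
    unfolding homogeneous_element_def strand_sum strand_monomial_term by (intro sum.cong) auto
  ultimately show "strand ls t' (homogeneous_element ls t c) \<rho> = (if t' = t then c else (\<lambda>_. 0)) \<rho>"
    by (auto split: if_splits)
qed

lemma homogeneous_element_free:
  assumes "supported_on B c"
  shows "homogeneous_element ls t c \<in> free_module B"
  unfolding free_module_def
proof (intro CollectI subsetI, rule ccontr)
  fix \<rho> assume \<rho>: "\<rho> \<in> Poly_Mapping.keys (homogeneous_element ls t c)" "\<rho> \<notin> B"
  have "Poly_Mapping.lookup (homogeneous_element ls t c) \<rho> = 0"
    unfolding homogeneous_element_def lookup_sum
    by (intro sum.neutral) (use supported_onD[OF assms \<rho>(2)] in \<open>auto simp: lookup_single when_def\<close>)
  then show False using \<rho>(1) by (simp add: in_keys_iff)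
qed

lemma free_module_sum:
  assumes "\<And>i. i \<in> A \<Longrightarrow> f i \<in> free_module B"
  shows "(\<Sum>i\<in>A. f i) \<in> free_module B"
  using assms
proof (induction A rule: infinite_finite_induct)
  case (insert i A)
  then have "f i \<in> free_module B" "(\<Sum>i\<in>A. f i) \<in> free_module B" by auto
  then show ?case
    using insert.hyps keys_add[of "f i" "\<Sum>i\<in>A. f i"] by (auto simp: free_module_def)
qed (auto simp: free_module_def)

lemma strand_supported:
  assumes "u \<in> free_module B"
  shows "supported_on {\<sigma> \<in> B. mdeg ls \<sigma> mdvd t} (strand ls t u)"
  unfolding supported_on_def
proof (intro allI impI)
  fix \<sigma> assume "\<sigma> \<notin> {\<sigma> \<in> B. mdeg ls \<sigma> mdvd t}"
  then have "Poly_Mapping.lookup u \<sigma> = 0 \<or> \<not> mdeg ls \<sigma> mdvd t"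
    using assms by (auto simp: free_module_def in_keys_iff)
  then show "strand ls t u \<sigma> = 0" by (auto simp: strand_def)
qed

lemma lookup_smul: "Poly_Mapping.lookup (smul p u) b = p * Poly_Mapping.lookup u b"
  by (simp add: Poly_Mapping.map.rep_eq when_def)

lemma psign_insert_same: "psign (insert r \<rho>) r = psign \<rho> r"
  unfolding psign_def by (rule arg_cong[where f = "\<lambda>A. (-1) ^ card A"]) auto

text \<open>
  In a fixed multidegree the monomial coefficients of the Taylor differential become 1, and what
  remains is the simplicial boundary. Consequently exactness over the polynomial ring is exactness
  over the field for each multidegree.
\<close>

lemma strand_lin_ext_taylor_diff:
  fixes u :: "nat set \<Rightarrow>\<^sub>0 ('x::finite, 'k::field) mpoly"
  assumes u: "u \<in> free_module (Pow {..<length ls})"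
  shows "strand ls t (lin_ext (taylor_diff ls j) u) = bdry (length ls) (strand ls t u)"
proof
  fix \<rho>
  let ?n = "length ls"
  show "strand ls t (lin_ext (taylor_diff ls j) u) \<rho> = bdry ?n (strand ls t u) \<rho>"
  proof (cases "mdeg ls \<rho> mdvd t")
    case False
    have "strand ls t u (insert r \<rho>) = 0" for r
    proof (cases "insert r \<rho> \<in> Poly_Mapping.keys u")
      case True
      then have "finite (insert r \<rho>)" using u by (auto simp: free_module_def intro: finite_subset)
      then have "mdeg ls \<rho> mdvd mdeg ls (insert r \<rho>)" by (rule mdeg_mono) auto
      then show ?thesis using False mdvd_trans by (auto simp: strand_def)
    qed (auto simp: strand_def in_keys_iff)
    then show ?thesis using False by (simp add: strand_def bdry_def)
  next
    case True
    define s where "s = t - mdeg ls \<rho>"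
    have t: "t = s + mdeg ls \<rho>" using True by (auto simp: s_def mdvd_def add.commute)
    define X where "X \<sigma> r = Poly_Mapping.lookup (Poly_Mapping.lookup u \<sigma> *
      ((-1) ^ card {s \<in> \<sigma>. s < r} * mon (mdeg ls \<sigma> - mdeg ls (\<sigma> - {r})))) s" for \<sigma> r
    have key: "finite \<sigma>" "\<sigma> \<subseteq> {..<?n}" if "\<sigma> \<in> Poly_Mapping.keys u" for \<sigma>
      using u that by (auto simp: free_module_def intro: finite_subset)
    have X: "X (insert r \<rho>) r = psign \<rho> r * strand ls t u (insert r \<rho>)"
      if r: "r \<notin> \<rho>" and "insert r \<rho> \<in> Poly_Mapping.keys u" for r
    proof -
      let ?\<sigma> = "insert r \<rho>" and ?p = "Poly_Mapping.lookup u (insert r \<rho>)"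
      let ?v = "mdeg ls ?\<sigma> - mdeg ls \<rho>"
      have "finite ?\<sigma>" using that(2) by (rule key(1))
      then have "mdeg ls \<rho> mdvd mdeg ls ?\<sigma>" by (rule mdeg_mono) auto
      then have le: "Poly_Mapping.lookup (mdeg ls \<rho>) x \<le> Poly_Mapping.lookup (mdeg ls ?\<sigma>) x" for x
        by (simp add: mdvd_iff)
      have 1: "?v mdvd s \<longleftrightarrow> mdeg ls ?\<sigma> mdvd t"
        unfolding mdvd_iff
      proof (intro all_cong1)
        fix x
        show "Poly_Mapping.lookup ?v x \<le> Poly_Mapping.lookup s x
            \<longleftrightarrow> Poly_Mapping.lookup (mdeg ls ?\<sigma>) x \<le> Poly_Mapping.lookup t x"
          using le[of x] by (simp add: t lookup_add lookup_minus le_diff_conv)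
      qed
      have 2: "s - ?v = t - mdeg ls ?\<sigma>"
      proof (rule poly_mapping_eqI)
        fix x
        show "Poly_Mapping.lookup (s - ?v) x = Poly_Mapping.lookup (t - mdeg ls ?\<sigma>) x"
          using le[of x] by (simp add: t lookup_add lookup_minus)
      qed
      have "X ?\<sigma> r = psign ?\<sigma> r * Poly_Mapping.lookup (?p * mon ?v) s"
      proof -
        have "?\<sigma> - {r} = \<rho>" using r by auto
        then show ?thesis
          by (simp only: X_def psign_def mult.left_commute[of ?p] lookup_minus_one_power_mult)
      qed
      also have "\<dots> = psign \<rho> r * strand ls t u ?\<sigma>"
        by (simp add: lookup_mult_mon 1 2 psign_insert_same strand_def)
      finally show ?thesis .
    qed
    have "strand ls t (lin_ext (taylor_diff ls j) u) \<rho>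
        = Poly_Mapping.lookup (Poly_Mapping.lookup (lin_ext (taylor_diff ls j) u) \<rho>) s"
      by (simp only: strand_def s_def True if_True)
    also have "\<dots> = (\<Sum>\<sigma>\<in>Poly_Mapping.keys u. \<Sum>r\<in>\<sigma>. if \<sigma> - {r} = \<rho> then X \<sigma> r else 0)"
      unfolding lin_ext_def lookup_sum lookup_smul
    proof (rule sum.cong[OF refl])
      fix \<sigma>
      have "Poly_Mapping.lookup (taylor_diff ls j \<sigma> :: nat set \<Rightarrow>\<^sub>0 ('x, 'k) mpoly) \<rho> = (\<Sum>r\<in>\<sigma>. if \<sigma> - {r} = \<rho>
          then (-1) ^ card {s \<in> \<sigma>. s < r} * mon (mdeg ls \<sigma> - mdeg ls (\<sigma> - {r})) else 0)"
        unfolding taylor_diff_def lookup_sum by (intro sum.cong) (auto simp: lookup_single when_def)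
      then show "Poly_Mapping.lookup (Poly_Mapping.lookup u \<sigma> * Poly_Mapping.lookup (taylor_diff ls j \<sigma>) \<rho>) s
          = (\<Sum>r\<in>\<sigma>. if \<sigma> - {r} = \<rho> then X \<sigma> r else 0)"
        unfolding X_def by (auto simp: sum_distrib_left lookup_sum intro!: sum.cong)
    qed
    also have "\<dots> = (\<Sum>\<sigma>\<in>Poly_Mapping.keys u. \<Sum>r\<in>{..<?n}.
        if r \<notin> \<rho> \<and> \<sigma> = insert r \<rho> then X \<sigma> r else 0)"
    proof (rule sum.cong[OF refl])
      fix \<sigma> assume \<sigma>: "\<sigma> \<in> Poly_Mapping.keys u"
      have eq: "(r \<notin> \<rho> \<and> \<sigma> = insert r \<rho>) \<longleftrightarrow> (r \<in> \<sigma> \<and> \<sigma> - {r} = \<rho>)" for r by auto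
      show "(\<Sum>r\<in>\<sigma>. if \<sigma> - {r} = \<rho> then X \<sigma> r else 0)
          = (\<Sum>r\<in>{..<?n}. if r \<notin> \<rho> \<and> \<sigma> = insert r \<rho> then X \<sigma> r else 0)"
        unfolding eq using key[OF \<sigma>] by (intro sum.mono_neutral_cong_left) auto
    qed
    also have "\<dots> = (\<Sum>r\<in>{..<?n}. \<Sum>\<sigma>\<in>Poly_Mapping.keys u.
        if r \<notin> \<rho> \<and> \<sigma> = insert r \<rho> then X \<sigma> r else 0)"
      by (rule sum.swap)
    also have "\<dots> = (\<Sum>r\<in>{..<?n}. if r \<in> \<rho> then 0 else psign \<rho> r * strand ls t u (insert r \<rho>))"
    proof (rule sum.cong[OF refl])
      fix r
      have "strand ls t u (insert r \<rho>) = 0" if "insert r \<rho> \<notin> Poly_Mapping.keys u"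
        using that by (simp add: strand_def in_keys_iff)
      then show "(\<Sum>\<sigma>\<in>Poly_Mapping.keys u. if r \<notin> \<rho> \<and> \<sigma> = insert r \<rho> then X \<sigma> r else 0)
          = (if r \<in> \<rho> then 0 else psign \<rho> r * strand ls t u (insert r \<rho>))"
        using X[of r] by (cases "r \<in> \<rho>"; cases "insert r \<rho> \<in> Poly_Mapping.keys u") simp_all
    qed
    also have "\<dots> = bdry ?n (strand ls t u) \<rho>"
      unfolding bdry_def by (intro sum.mono_neutral_cong_right) auto
    finally show ?thesis .
  qed
qed

section \<open>The Scarf complex\<close>

text \<open>
  The faces in multidegree \<open>t\<close>: these are the only Scarf symbols that can occur in
  \<open>strand ls t u\<close> for an element \<open>u\<close> of the Scarf complex.
\<close>

definition scarf_faces :: "'x::finite monom list \<Rightarrow> 'x monom \<Rightarrow> nat set set"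
  where "scarf_faces ls t = {\<sigma>. \<sigma> \<in> scarf_basis ls (card \<sigma>) \<and> mdeg ls \<sigma> mdvd t}"

lemma scarf_basisD:
  assumes "\<sigma> \<in> scarf_basis ls j" "\<tau> \<subseteq> {..<length ls}" "mdeg ls \<tau> = mdeg ls \<sigma>"
  shows "\<tau> = \<sigma>"
  using assms by (auto simp: scarf_basis_def taylor_symbols_def)

lemma scarf_faces_Pow: "scarf_faces ls t \<subseteq> Pow {..<length ls}"
  by (auto simp: scarf_faces_def scarf_basis_def taylor_symbols_def)

lemma scarf_basis_Pow: "scarf_basis ls j \<subseteq> Pow {..<length ls}"
  by (auto simp: scarf_basis_def taylor_symbols_def)

lemma scarf_basis_finite: "\<sigma> \<in> scarf_basis ls j \<Longrightarrow> finite \<sigma>"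
  using scarf_basis_Pow[of ls j] finite_subset[of \<sigma> "{..<length ls}"] by auto

lemma scarf_faces_finite: "\<sigma> \<in> scarf_faces ls t \<Longrightarrow> finite \<sigma>"
  using scarf_faces_Pow[of ls t] finite_subset[of \<sigma> "{..<length ls}"] by auto

lemma scarf_basis_card: "\<sigma> \<in> scarf_basis ls j \<Longrightarrow> card \<sigma> = j"
  by (simp add: scarf_basis_def)

text \<open>
  Otherwise \<open>\<rho>\<close> and \<open>insert r \<rho>\<close> would have the same multidegree.
\<close>

lemma scarf_basis_insert_mdeg:
  assumes "insert r \<rho> \<in> scarf_basis ls j" "r \<notin> \<rho>"
  shows "\<not> ls ! r mdvd mdeg ls \<rho>"
proof
  have sub: "\<rho> \<subseteq> {..<length ls}" using assms(1) scarf_basis_Pow by blast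
  assume "ls ! r mdvd mdeg ls \<rho>"
  then have "mdeg ls \<rho> = mdeg ls (insert r \<rho>)"
    using mdeg_insert[of \<rho> ls r] finite_subset[OF sub] by simp
  then show False using scarf_basisD[OF assms(1) sub] assms(2) by auto
qed

text \<open>
  If \<open>\<tau>\<close> has the multidegree of \<open>\<rho>\<close>, then \<open>\<tau> \<union> (\<sigma> - \<rho>)\<close> has the multidegree of \<open>\<sigma>\<close>, hence
  equals \<open>\<sigma>\<close>. So \<open>\<tau>\<close> lies between \<open>\<rho>\<close> and \<open>\<sigma>\<close>, and an element of \<open>\<tau> - \<rho>\<close> would be
  redundant in \<open>\<sigma>\<close>.
\<close>

lemma scarf_basis_subset:
  assumes \<sigma>: "\<sigma> \<in> scarf_basis ls j" and sub: "\<rho> \<subseteq> \<sigma>"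
  shows "\<rho> \<in> scarf_basis ls (card \<rho>)"
proof -
  have n: "\<sigma> \<subseteq> {..<length ls}" using \<sigma> scarf_basis_Pow by blast
  then have fin: "finite \<sigma>" by (rule finite_subset) simp
  have "\<tau> = \<rho>" if \<tau>: "\<tau> \<subseteq> {..<length ls}" "mdeg ls \<tau> = mdeg ls \<rho>" for \<tau>
  proof -
    have fin\<tau>: "finite \<tau>" using \<tau>(1) by (rule finite_subset) simp
    \<comment> \<open>Replacing \<open>\<rho>\<close> by \<open>\<tau>\<close> inside \<open>\<sigma>\<close> keeps the multidegree, which only \<open>\<sigma>\<close> has.\<close>
    have iff: "mdeg ls (\<tau> \<union> A) mdvd t \<longleftrightarrow> mdeg ls (\<rho> \<union> A) mdvd t" if "finite A" for A t
    proof -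
      have "mdeg ls (\<tau> \<union> A) mdvd t \<longleftrightarrow> mdeg ls \<tau> mdvd t \<and> mdeg ls A mdvd t"
        using that fin\<tau> by (auto simp: mdeg_mdvd_iff)
      moreover have "mdeg ls (\<rho> \<union> A) mdvd t \<longleftrightarrow> mdeg ls \<rho> mdvd t \<and> mdeg ls A mdvd t"
        using that finite_subset[OF sub fin] by (auto simp: mdeg_mdvd_iff)
      ultimately show ?thesis using \<tau>(2) by simp
    qed
    have "mdeg ls (\<tau> \<union> A) = mdeg ls (\<rho> \<union> A)" if "finite A" for A
      using iff[OF that] mdvd_antisym mdvd_refl by blast
    then have "mdeg ls (\<tau> \<union> (\<sigma> - \<rho>)) = mdeg ls \<sigma>"
      using fin sub by (metis Un_Diff_cancel finite_Diff sup.absorb2)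
    then have eq: "\<tau> \<union> (\<sigma> - \<rho>) = \<sigma>"
      using \<tau> n by (intro scarf_basisD[OF \<sigma>]) auto
    have "\<rho> \<subseteq> \<tau>" using eq sub by blast
    moreover have "r \<notin> \<tau>" if r: "r \<in> \<sigma>" "r \<notin> \<rho>" for r
    proof
      assume "r \<in> \<tau>"
      then have "ls ! r mdvd mdeg ls \<tau>" using fin\<tau> by (simp add: generator_mdvd_mdeg)
      then have "ls ! r mdvd mdeg ls \<rho>" using \<tau> by simp
      then have "ls ! r mdvd mdeg ls (\<sigma> - {r})"
        using mdeg_mono[of "\<sigma> - {r}" \<rho> ls] fin sub r mdvd_trans by blast
      moreover have "insert r (\<sigma> - {r}) \<in> scarf_basis ls j" using \<sigma> r by (simp add: insert_absorb)
      ultimately show False using scarf_basis_insert_mdeg by blast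
    qed
    ultimately show "\<tau> = \<rho>" using eq by blast
  qed
  then show ?thesis using n sub by (auto simp: scarf_basis_def taylor_symbols_def)
qed

lemma scarf_faces_subset_closed: "subset_closed (scarf_faces ls t)"
  unfolding subset_closed_def
proof (intro ballI allI impI)
  fix \<sigma> \<rho> assume *: "\<sigma> \<in> scarf_faces ls t" "\<rho> \<subseteq> \<sigma>"
  have "finite \<sigma>" using *(1) by (rule scarf_faces_finite)
  then have "mdeg ls \<rho> mdvd mdeg ls \<sigma>" using * by (intro mdeg_mono)
  then show "\<rho> \<in> scarf_faces ls t"
    using * scarf_basis_subset[of \<sigma> ls _ \<rho>] mdvd_trans[of "mdeg ls \<rho>" "mdeg ls \<sigma>" t]
    by (auto simp: scarf_faces_def)
qed

lemma scarf_faces_eq: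
  "{\<sigma> \<in> scarf_basis ls j. mdeg ls \<sigma> mdvd t} = {\<sigma> \<in> scarf_faces ls t. card \<sigma> = j}"
  unfolding scarf_faces_def using scarf_basis_card by blast

lemma free_module_mono: "B \<subseteq> C \<Longrightarrow> free_module B \<subseteq> free_module C"
  by (auto simp: free_module_def)

lemma strand_lin_ext_scarf:
  assumes "u \<in> free_module (scarf_basis ls j)"
  shows "strand ls t (lin_ext (taylor_diff ls i) u) = bdry (length ls) (strand ls t u)"
  using assms free_module_mono[OF scarf_basis_Pow] by (intro strand_lin_ext_taylor_diff) blast

lemma scarf_strand_supported:
  assumes "u \<in> free_module (scarf_basis ls j)"
  shows "supported_on {\<sigma> \<in> scarf_faces ls t. card \<sigma> = j} (strand ls t u)"
  unfolding scarf_faces_eq[symmetric] by (rule strand_supported[OF assms])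

lemma scarf_cycle_iff:
  fixes u :: "nat set \<Rightarrow>\<^sub>0 ('x::finite, 'k::field) mpoly"
  assumes "u \<in> free_module (scarf_basis ls j)"
  shows "lin_ext (taylor_diff ls i) u = 0 \<longleftrightarrow> (\<forall>t. bdry (length ls) (strand ls t u) = (\<lambda>_. 0))"
proof
  assume "lin_ext (taylor_diff ls i) u = 0"
  then show "\<forall>t. bdry (length ls) (strand ls t u) = (\<lambda>_. 0)"
    unfolding strand_lin_ext_scarf[OF assms, of _ i, symmetric] by (simp add: strand_zero)
next
  assume "\<forall>t. bdry (length ls) (strand ls t u) = (\<lambda>_. 0)"
  then show "lin_ext (taylor_diff ls i) u = 0"
    by (intro strand_eqI[of ls]) (simp only: strand_lin_ext_scarf[OF assms] strand_zero)
qed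

text \<open>
  Being a boundary can be decided strand by strand: chains of preimages, truncated to the right
  cardinality, are glued over the finitely many multidegrees in which \<open>u\<close> is nonzero.
\<close>

lemma scarf_boundary_iff:
  fixes u :: "nat set \<Rightarrow>\<^sub>0 ('x::finite, 'k::field) mpoly"
  assumes u: "u \<in> free_module (scarf_basis ls j)"
  shows "u \<in> lin_ext (taylor_diff ls i) ` free_module (scarf_basis ls (Suc j)) \<longleftrightarrow>
    (\<forall>t. \<exists>w. supported_on (scarf_faces ls t) w \<and> bdry (length ls) w = strand ls t u)"
proof
  assume "u \<in> lin_ext (taylor_diff ls i) ` free_module (scarf_basis ls (Suc j))"
  then obtain v where v: "v \<in> free_module (scarf_basis ls (Suc j))" "u = lin_ext (taylor_diff ls i) v"
    by blast
  have "supported_on (scarf_faces ls t) (strand ls t v)" for t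
    using scarf_strand_supported[OF v(1), of t] by (auto simp: supported_on_def)
  then show "\<forall>t. \<exists>w. supported_on (scarf_faces ls t) w \<and> bdry (length ls) w = strand ls t u"
    using strand_lin_ext_scarf[OF v(1)] v(2) by metis
next
  let ?n = "length ls"
  assume "\<forall>t. \<exists>w. supported_on (scarf_faces ls t) w \<and> bdry ?n w = strand ls t u"
  then obtain w0 where w0: "\<And>t. supported_on (scarf_faces ls t) (w0 t)"
      "\<And>t. bdry ?n (w0 t) = strand ls t u"
    by metis
  define w where "w t = (\<lambda>\<sigma>. if card \<sigma> = Suc j then w0 t \<sigma> else 0)" for t
  have supp: "supported_on {\<sigma> \<in> scarf_faces ls t. card \<sigma> = Suc j} (w t)" for t
    using w0(1)[of t] by (auto simp: supported_on_def w_def)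
  have bdry_w: "bdry ?n (w t) = strand ls t u" for t
  proof
    fix \<rho>
    have "supported_on (Pow {..<?n}) (w0 t)"
      using w0(1)[of t] scarf_faces_Pow[of ls t] by (auto simp: supported_on_def)
    then have "bdry ?n (w t) \<rho> = (if card \<rho> = j then strand ls t u \<rho> else 0)"
      unfolding w_def by (simp add: bdry_restrict_card w0(2))
    also have "\<dots> = strand ls t u \<rho>"
      using supported_onD[OF scarf_strand_supported[OF u, of t], of \<rho>] by auto
    finally show "bdry ?n (w t) \<rho> = strand ls t u \<rho>" .
  qed
  define T where "T = {t. strand ls t u \<noteq> (\<lambda>_. 0)}"
  define v where "v = (\<Sum>t\<in>T. homogeneous_element ls t (w t))"
  have T: "finite T" unfolding T_def by (rule finite_strands)
  have v: "v \<in> free_module (scarf_basis ls (Suc j))"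
    unfolding v_def
  proof (intro free_module_sum homogeneous_element_free)
    fix t show "supported_on (scarf_basis ls (Suc j)) (w t)"
      using supp[of t] unfolding scarf_faces_eq[symmetric] by (auto simp: supported_on_def)
  qed
  have supp': "supported_on {\<sigma> \<in> Pow {..<?n}. mdeg ls \<sigma> mdvd t} (w t)" for t
    using supp[of t] scarf_faces_Pow[of ls t] by (auto simp: supported_on_def scarf_faces_def)
  have "strand ls t v \<sigma> = (if t \<in> T then w t \<sigma> else 0)" for t \<sigma>
  proof -
    have "strand ls t v \<sigma> = (\<Sum>t'\<in>T. if t = t' then w t \<sigma> else 0)"
      unfolding v_def strand_sum strand_homogeneous_element[OF supp']
      by (intro sum.cong) auto
    then show ?thesis using T by simp
  qed
  then have strand_v: "strand ls t v = (if t \<in> T then w t else (\<lambda>_. 0))" for t by (auto simp: fun_eq_iff)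
  have "strand ls t (lin_ext (taylor_diff ls i) v) = strand ls t u" for t
    unfolding strand_lin_ext_scarf[OF v] strand_v by (simp add: bdry_w bdry_zero) (simp add: T_def)
  then have "lin_ext (taylor_diff ls i) v = u" by (rule strand_eqI)
  then show "u \<in> lin_ext (taylor_diff ls i) ` free_module (scarf_basis ls (Suc j))" using v by blast
qed

lemma lin_ext_scarf_free:
  fixes u :: "nat set \<Rightarrow>\<^sub>0 ('x::finite, 'k::field) mpoly"
  assumes "u \<in> free_module (scarf_basis ls (Suc j))"
  shows "lin_ext (taylor_diff ls i) u \<in> free_module (scarf_basis ls j)"
  unfolding free_module_def
proof (intro CollectI subsetI, rule ccontr)
  fix \<rho> let ?v = "lin_ext (taylor_diff ls i) u"
  assume \<rho>: "\<rho> \<in> Poly_Mapping.keys ?v" "\<rho> \<notin> scarf_basis ls j"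
  have "strand ls t u (insert r \<rho>) = 0" if "r \<notin> \<rho>" for r t
  proof (rule ccontr)
    assume "strand ls t u (insert r \<rho>) \<noteq> 0"
    then have ins: "insert r \<rho> \<in> scarf_basis ls (Suc j)"
      using supported_onD[OF strand_supported[OF assms, of ls t], of "insert r \<rho>"] by blast
    have "finite (insert r \<rho>)" by (rule scarf_basis_finite[OF ins])
    then have "card \<rho> = j" using scarf_basis_card[OF ins] that by simp
    moreover have "\<rho> \<in> scarf_basis ls (card \<rho>)" by (rule scarf_basis_subset[OF ins]) auto
    ultimately show False using \<rho>(2) by simp
  qed
  then have "bdry (length ls) (strand ls t u) \<rho> = 0" for t by (simp add: bdry_def)
  then have "Poly_Mapping.lookup (Poly_Mapping.lookup ?v \<rho>) s = 0" for s
    by (simp add: lookup_eq_strand[where ls = ls] strand_lin_ext_scarf[OF assms])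
  then have "Poly_Mapping.lookup ?v \<rho> = 0" by (intro poly_mapping_eqI) simp
  then show False using \<rho>(1) by (simp add: in_keys_iff)
qed

lemma lin_ext_single: "lin_ext f (Poly_Mapping.single b 1) = f b"
  by (intro poly_mapping_eqI) (simp add: lin_ext_def lookup_smul)

text \<open>
  The constant term of the coefficient at \<open>\<rho>\<close> comes from cofaces \<open>insert r \<rho>\<close> of the same
  multidegree as \<open>\<rho>\<close>, and Scarf symbols have no such faces.
\<close>

lemma scarf_minimal:
  fixes u :: "nat set \<Rightarrow>\<^sub>0 ('x::finite, 'k::field) mpoly"
  assumes u: "u \<in> free_module (scarf_basis ls j)"
  shows "Poly_Mapping.lookup (lin_ext (taylor_diff ls i) u) \<rho> \<in> irrelevant_ideal"
proof (rule mem_irrelevant_ideal)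
  have "strand ls (mdeg ls \<rho>) u (insert r \<rho>) = 0" if r: "r \<notin> \<rho>" for r
  proof (rule ccontr)
    assume "strand ls (mdeg ls \<rho>) u (insert r \<rho>) \<noteq> 0"
    then have ins: "insert r \<rho> \<in> scarf_basis ls j" "mdeg ls (insert r \<rho>) mdvd mdeg ls \<rho>"
      using supported_onD[OF strand_supported[OF u, of ls "mdeg ls \<rho>"], of "insert r \<rho>"] by blast+
    have "finite (insert r \<rho>)" by (rule scarf_basis_finite[OF ins(1)])
    then show False using ins scarf_basis_insert_mdeg[OF ins(1) r] by (simp add: mdeg_mdvd_iff)
  qed
  then show "Poly_Mapping.lookup (Poly_Mapping.lookup (lin_ext (taylor_diff ls i) u) \<rho>) 0 = 0"
    by (simp add: lookup_eq_strand[where ls = ls] strand_lin_ext_scarf[OF u] bdry_def)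
qed

lemma scarf_basis_0: "scarf_basis ls 0 \<subseteq> {{}}"
proof
  fix \<sigma> assume \<sigma>: "\<sigma> \<in> scarf_basis ls 0"
  have "finite \<sigma>" using \<sigma> by (rule scarf_basis_finite)
  then show "\<sigma> \<in> {{}}" using scarf_basis_card[OF \<sigma>] by simp
qed

lemma lin_form_degree_0:
  assumes "u \<in> free_module (scarf_basis ls 0)"
  shows "lin_form (\<lambda>_. 1) u = Poly_Mapping.lookup u {}"
proof -
  have sub: "Poly_Mapping.keys u \<subseteq> {{}}" using assms scarf_basis_0 unfolding free_module_def by blast
  have "lin_form (\<lambda>_. 1) u = (\<Sum>b\<in>{{}}. Poly_Mapping.lookup u b)"
    unfolding lin_form_def mult_1_right
    by (rule sum.mono_neutral_left) (use sub in \<open>auto simp: in_keys_iff\<close>)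
  then show ?thesis by simp
qed

text \<open>
  If no generator divides \<open>t\<close>, the only face in degree \<open>t\<close> is the empty set. This does not disturb
  exactness in positive degree, and in degree 0 it says that exactly the monomials outside \<open>M\<close>
  survive, as the augmentation to the quotient by \<open>M\<close> demands. Without the generator 1 the empty
  symbol is Scarf, so the augmentation is onto.
\<close>

theorem scarf_if_acyclic:
  fixes M :: "('x::finite, 'k::field) mpoly set"
  assumes M: "ideal_of (mon ` set ls) = M" and nonunit: "0 \<notin> set ls"
    and acyclic: "\<And>t i. i < length ls \<Longrightarrow> ls ! i mdvd t \<Longrightarrow>
      acyclic_complex TYPE('k) (length ls) (scarf_faces ls t)"
  shows "scarf ls M"
proof -
  let ?n = "length ls" and ?F = "\<lambda>j. free_module (scarf_basis ls j) :: (nat set \<Rightarrow>\<^sub>0 ('x, 'k) mpoly) set"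
  have mem_M: "p \<in> M \<longleftrightarrow> (\<forall>t\<in>Poly_Mapping.keys p. \<exists>i<?n. ls ! i mdvd t)" for p
  proof -
    have "(\<exists>g\<in>set ls. g mdvd t) \<longleftrightarrow> (\<exists>i<?n. ls ! i mdvd t)" for t by (metis in_set_conv_nth)
    then show ?thesis unfolding M[symmetric] mem_ideal_of_monomials by simp
  qed
  have empty: "{} \<in> scarf_basis ls 0"
  proof -
    have "\<tau> = {}" if \<tau>: "\<tau> \<subseteq> {..<?n}" "mdeg ls \<tau> = 0" for \<tau>
    proof (rule ccontr)
      assume "\<tau> \<noteq> {}"
      then obtain i where i: "i \<in> \<tau>" by blast
      then have "ls ! i mdvd 0" using \<tau> generator_mdvd_mdeg[of \<tau> i ls] by (simp add: finite_subset)
      then have "ls ! i = 0" using mdvd_antisym mdvd_zero by blast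
      then show False using nonunit i \<tau>(1) by (metis lessThan_iff nth_mem subsetD)
    qed
    then show ?thesis by (simp add: scarf_basis_def taylor_symbols_def mdeg_empty)
  qed
  have Pow: "supported_on (Pow {..<?n}) c" if "supported_on (scarf_faces ls t) c" for c :: "nat set \<Rightarrow> 'k" and t
    using that scarf_faces_Pow[of ls t] by (auto simp: supported_on_def)
  have supp: "supported_on (scarf_faces ls t) (strand ls t u)" if "u \<in> ?F j" for u t j
    using scarf_strand_supported[OF that, of t] by (auto simp: supported_on_def)
  have trivial: "\<exists>w :: nat set \<Rightarrow> 'k. supported_on K w \<and> bdry ?n w = (\<lambda>_. 0)" for K
    by (rule exI[of _ "\<lambda>_. 0"]) (simp add: bdry_zero supported_on_def)
  have 1: "\<forall>j. \<forall>b\<in>scarf_basis ls (Suc j). (taylor_diff ls (Suc j) b :: nat set \<Rightarrow>\<^sub>0 ('x, 'k) mpoly) \<in> ?F j"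
  proof (intro allI ballI)
    fix j b assume "b \<in> scarf_basis ls (Suc j)"
    then have "Poly_Mapping.single b 1 \<in> ?F (Suc j)" by (simp add: free_module_def)
    then show "(taylor_diff ls (Suc j) b :: nat set \<Rightarrow>\<^sub>0 ('x, 'k) mpoly) \<in> ?F j"
      using lin_ext_scarf_free[of _ ls j "Suc j"] by (metis lin_ext_single)
  qed
  have 2: "{u \<in> ?F (Suc j). lin_ext (taylor_diff ls (Suc j)) u = 0}
      = lin_ext (taylor_diff ls (Suc (Suc j))) ` ?F (Suc (Suc j))" for j
  proof (intro equalityI subsetI)
    fix u assume "u \<in> {u \<in> ?F (Suc j). lin_ext (taylor_diff ls (Suc j)) u = 0}"
    then have u: "u \<in> ?F (Suc j)" and cycle: "\<And>t. bdry ?n (strand ls t u) = (\<lambda>_. 0)"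
      using scarf_cycle_iff by blast+
    have "\<exists>w. supported_on (scarf_faces ls t) w \<and> bdry ?n w = strand ls t u" for t
    proof (cases "\<exists>i<?n. ls ! i mdvd t")
      case True
      then show ?thesis using acyclic cycle[of t] supp[OF u, of t] unfolding acyclic_complex_def by blast
    next
      case False
      have "strand ls t u \<sigma> = 0" for \<sigma>
      proof (rule ccontr)
        assume "strand ls t u \<sigma> \<noteq> 0"
        then have \<sigma>: "\<sigma> \<in> scarf_faces ls t" "card \<sigma> = Suc j"
          using supported_onD[OF scarf_strand_supported[OF u, of t]] by blast+
        have "\<sigma> \<subseteq> {..<?n}" using \<sigma>(1) scarf_faces_Pow[of ls t] by blast
        moreover have "\<forall>i\<in>\<sigma>. ls ! i mdvd t"
          using \<sigma>(1) scarf_faces_finite[OF \<sigma>(1)] by (simp add: scarf_faces_def mdeg_mdvd_iff)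
        moreover have "\<sigma> \<noteq> {}" using \<sigma>(2) by auto
        ultimately show False using False by blast
      qed
      then have "strand ls t u = (\<lambda>_. 0)" by auto
      then show ?thesis using trivial by simp
    qed
    then show "u \<in> lin_ext (taylor_diff ls (Suc (Suc j))) ` ?F (Suc (Suc j))"
      unfolding scarf_boundary_iff[OF u] by blast
  next
    fix u assume u: "u \<in> lin_ext (taylor_diff ls (Suc (Suc j))) ` ?F (Suc (Suc j))"
    then obtain v where v: "v \<in> ?F (Suc (Suc j))" "u = lin_ext (taylor_diff ls (Suc (Suc j))) v" by blast
    have uF: "u \<in> ?F (Suc j)" using v lin_ext_scarf_free by blast
    have "bdry ?n (strand ls t u) = (\<lambda>_. 0)" for t
      unfolding v(2) strand_lin_ext_scarf[OF v(1)] by (rule bdry_bdry[OF Pow[OF supp[OF v(1)]]])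
    then show "u \<in> {u \<in> ?F (Suc j). lin_ext (taylor_diff ls (Suc j)) u = 0}"
      using uF scarf_cycle_iff by blast
  qed
  have 3: "{u \<in> ?F 0. lin_form (\<lambda>_. 1) u \<in> M} = lin_ext (taylor_diff ls 1) ` ?F 1"
  proof -
    have "lin_form (\<lambda>_. 1) u \<in> M \<longleftrightarrow> u \<in> lin_ext (taylor_diff ls 1) ` ?F 1" if u: "u \<in> ?F 0" for u
    proof -
      have strand_u: "strand ls t u = (\<lambda>\<sigma>. if \<sigma> = {} then Poly_Mapping.lookup (Poly_Mapping.lookup u {}) t else 0)" for t
      proof
        fix \<sigma>
        show "strand ls t u \<sigma> = (if \<sigma> = {} then Poly_Mapping.lookup (Poly_Mapping.lookup u {}) t else 0)"
        proof (cases "\<sigma> = {}")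
          case True
          then show ?thesis by (simp add: strand_def mdeg_empty mdvd_zero)
        next
          case False
          then have "\<sigma> \<notin> {\<sigma> \<in> scarf_basis ls 0. mdeg ls \<sigma> mdvd t}" using scarf_basis_0[of ls] by auto
          then show ?thesis using False supported_onD[OF strand_supported[OF u, of ls t]] by simp
        qed
      qed
      have "(\<exists>w. supported_on (scarf_faces ls t) w \<and> bdry ?n w = strand ls t u) \<longleftrightarrow>
          (t \<in> Poly_Mapping.keys (Poly_Mapping.lookup u {}) \<longrightarrow> (\<exists>i<?n. ls ! i mdvd t))" for t
      proof (cases "\<exists>i<?n. ls ! i mdvd t")
        case True
        have "bdry ?n (strand ls t u) = (\<lambda>_. 0)" by (simp add: bdry_def strand_u fun_eq_iff)
        then show ?thesis using True acyclic supp[OF u, of t] unfolding acyclic_complex_def by blast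
      next
        case False
        have "bdry ?n w {} = 0" if w: "supported_on (scarf_faces ls t) w" for w :: "nat set \<Rightarrow> 'k"
        proof -
          have "{r} \<notin> scarf_faces ls t" if "r < ?n" for r
            using False that by (auto simp: scarf_faces_def mdeg_mdvd_iff)
          then show ?thesis using supported_onD[OF w] by (simp add: bdry_def)
        qed
        moreover have "strand ls t u = (\<lambda>_. 0)" if "strand ls t u {} = 0"
          using that by (simp add: strand_u fun_eq_iff)
        ultimately have "(\<exists>w. supported_on (scarf_faces ls t) w \<and> bdry ?n w = strand ls t u) \<longleftrightarrow> strand ls t u {} = 0"
          using trivial by metis
        then show ?thesis using False by (auto simp: strand_u in_keys_iff)
      qed
      then show ?thesis
        unfolding lin_form_degree_0[OF u] mem_M One_nat_def scarf_boundary_iff[OF u] by blast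
    qed
    moreover have "lin_ext (taylor_diff ls 1) ` ?F 1 \<subseteq> ?F 0"
      using lin_ext_scarf_free[of _ ls 0] by auto
    ultimately show ?thesis by blast
  qed
  have 4: "\<exists>u\<in>?F 0. s - lin_form (\<lambda>_. 1) u \<in> M" for s
  proof -
    have u: "Poly_Mapping.single {} s \<in> ?F 0" using empty by (auto simp: free_module_def)
    then have "s - lin_form (\<lambda>_. 1) (Poly_Mapping.single ({} :: nat set) s) = 0"
      using lin_form_degree_0[OF u] by simp
    then have "s - lin_form (\<lambda>_. 1) (Poly_Mapping.single ({} :: nat set) s) \<in> M" by (simp add: mem_M)
    then show ?thesis using u by blast
  qed
  have 5: "\<forall>j. \<forall>u\<in>?F (Suc j). \<forall>\<rho>.
      Poly_Mapping.lookup (lin_ext (taylor_diff ls (Suc j)) u) \<rho> \<in> irrelevant_ideal"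
    using scarf_minimal by blast
  show ?thesis
    unfolding scarf_def minimal_free_resolution_def free_resolution_def
    by (intro conjI) (rule 1 3 5 allI[OF 2] allI[OF 4])+
qed

text \<open>
  A cycle in degree \<open>t\<close> is lifted to a homogeneous element of the Scarf complex, where exactness
  applies.
\<close>

theorem scarf_imp_exact:
  fixes M :: "('x::finite, 'k::field) mpoly set" and c :: "nat set \<Rightarrow> 'k"
  assumes "scarf ls M"
    and c: "supported_on {\<sigma> \<in> scarf_faces ls t. card \<sigma> = Suc j} c" "bdry (length ls) c = (\<lambda>_. 0)"
  shows "\<exists>w. supported_on (scarf_faces ls t) w \<and> bdry (length ls) w = c"
proof -
  let ?n = "length ls" and ?F = "\<lambda>j. free_module (scarf_basis ls j) :: (nat set \<Rightarrow>\<^sub>0 ('x, 'k) mpoly) set"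
  have exact: "{u \<in> ?F (Suc j). lin_ext (taylor_diff ls (Suc j)) u = 0}
      = lin_ext (taylor_diff ls (Suc (Suc j))) ` ?F (Suc (Suc j))"
    using assms(1) unfolding scarf_def minimal_free_resolution_def free_resolution_def by blast
  define u :: "nat set \<Rightarrow>\<^sub>0 ('x, 'k) mpoly" where "u = homogeneous_element ls t c"
  have u: "u \<in> ?F (Suc j)"
    unfolding u_def
  proof (rule homogeneous_element_free)
    show "supported_on (scarf_basis ls (Suc j)) c"
      using c(1) unfolding scarf_faces_eq[symmetric] by (auto simp: supported_on_def)
  qed
  have strand_u: "strand ls t' u = (if t' = t then c else (\<lambda>_. 0))" for t'
    unfolding u_def
  proof (rule strand_homogeneous_element)
    show "supported_on {\<sigma> \<in> Pow {..<?n}. mdeg ls \<sigma> mdvd t} c"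
      using c(1) scarf_faces_Pow[of ls t] by (auto simp: supported_on_def scarf_faces_def)
  qed
  have "lin_ext (taylor_diff ls (Suc j)) u = 0"
    unfolding scarf_cycle_iff[OF u] using c(2) by (simp add: strand_u bdry_zero)
  then have "u \<in> lin_ext (taylor_diff ls (Suc (Suc j))) ` ?F (Suc (Suc j))" using u exact by blast
  then have "\<exists>w. supported_on (scarf_faces ls t) w \<and> bdry ?n w = strand ls t u"
    unfolding scarf_boundary_iff[OF u] by blast
  then show ?thesis by (simp add: strand_u)
qed

section \<open>Ideals with two nondominant generators\<close>

lemma single_mdvd_iff: "Poly_Mapping.single x k mdvd t \<longleftrightarrow> k \<le> Poly_Mapping.lookup t x"
  by (auto simp: mdvd_iff lookup_single when_def)

text \<open>
  A power \<open>x\<^sup>k\<close> that divides \<open>ls ! i\<close> but no other generator divides the lcm. As \<open>k \<ge> 1\<close>, the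
  exponent of \<open>x\<close> in the lcm is attained by a member of \<open>\<sigma>\<close>, and this member can only be
  \<open>ls ! i\<close>.
\<close>

lemma dominant_mdvd_mdeg:
  assumes dom: "dominant (set ls) (ls ! i)" and ls: "distinct ls" "i < length ls"
    and \<sigma>: "\<sigma> \<subseteq> {..<length ls}" "ls ! i mdvd mdeg ls \<sigma>"
  shows "i \<in> \<sigma>"
proof -
  obtain x k where k: "k \<ge> 1" "Poly_Mapping.single x k mdvd ls ! i"
      "\<forall>m\<in>set ls - {ls ! i}. \<not> Poly_Mapping.single x k mdvd m"
    using dom unfolding dominant_def by blast
  have fin: "finite \<sigma>" using \<sigma>(1) by (rule finite_subset) simp
  have "k \<le> Poly_Mapping.lookup (mdeg ls \<sigma>) x"
    using mdvd_trans[OF k(2) \<sigma>(2)] by (simp add: single_mdvd_iff)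
  then have "\<exists>e\<in>insert 0 ((\<lambda>s. Poly_Mapping.lookup s x) ` (!) ls ` \<sigma>). k \<le> e"
    using fin by (simp add: mdeg_def lookup_mlcm Max_ge_iff)
  then obtain j where j: "j \<in> \<sigma>" "Poly_Mapping.single x k mdvd ls ! j"
    using k(1) by (auto simp: single_mdvd_iff)
  then have "ls ! j = ls ! i" using k(3) \<sigma>(1) nth_mem[of j ls] by blast
  then show ?thesis using j(1) ls \<sigma>(1) by (auto simp: nth_eq_iff_index_eq)
qed

text \<open>
  The parity count for a family of subsets of a square \<open>\<tau>\<close>, \<open>\<tau> \<union> {a}\<close>, \<open>\<tau> \<union> {b}\<close>,
  \<open>\<tau> \<union> {a, b}\<close>, whose memberships are \<open>p\<close>, \<open>q\<close>, \<open>r\<close>, \<open>s\<close>.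
\<close>

lemma even_of_four_bools:
  assumes "1 < (of_bool p + of_bool q + of_bool r + of_bool s :: nat)"
    and "\<not> q \<or> \<not> r \<or> s \<and> p" "\<not> s \<or> \<not> p \<or> q \<and> r"
  shows "even (of_bool p + of_bool q + of_bool r + of_bool s :: nat)"
  using assms by (cases p; cases q; cases r; cases s) simp_all

text \<open>
  Dominance enters only through the last condition, which makes \<open>a\<close> and \<open>b\<close> the only indices
  that may be redundant in an lcm.
\<close>

locale two_nondominant =
  fixes ls :: "'x::finite monom list" and a b :: nat
  assumes a: "a < length ls" and b: "b < length ls" and neq: "a \<noteq> b"
    and antichain: "\<And>i j. i < length ls \<Longrightarrow> j < length ls \<Longrightarrow> ls ! i mdvd ls ! j \<Longrightarrow> i = j"
    and dom: "\<And>i \<sigma>. i < length ls \<Longrightarrow> i \<noteq> a \<Longrightarrow> i \<noteq> b \<Longrightarrow> \<sigma> \<subseteq> {..<length ls} \<Longrightarrow>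
      ls ! i mdvd mdeg ls \<sigma> \<Longrightarrow> i \<in> \<sigma>"
begin

text \<open>
  Equivalently, the three sets obtained from \<open>\<tau>\<close> by adding \<open>a\<close>, \<open>b\<close> or both share a
  multidegree, and it differs from the one of \<open>\<tau>\<close>: the exact obstruction, both to evenness and
  to covering the Scarf complex by the stars of \<open>a\<close> and \<open>b\<close>.
\<close>

definition clash :: "nat set \<Rightarrow> bool"
  where "clash \<tau> \<longleftrightarrow> \<tau> \<subseteq> {..<length ls} \<and>
    \<not> ls ! a mdvd mdeg ls \<tau> \<and> \<not> ls ! b mdvd mdeg ls \<tau> \<and>
    ls ! a mdvd mdeg ls (insert b \<tau>) \<and> ls ! b mdvd mdeg ls (insert a \<tau>)"

lemma finite_indices: "\<sigma> \<subseteq> {..<length ls} \<Longrightarrow> finite \<sigma>"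
  using finite_subset[of \<sigma> "{..<length ls}"] by simp

lemma mdvd_mdeg_mono:
  assumes "s mdvd mdeg ls \<rho>" "\<rho> \<subseteq> \<sigma>" "\<sigma> \<subseteq> {..<length ls}"
  shows "s mdvd mdeg ls \<sigma>"
  using mdvd_trans[OF assms(1)] mdeg_mono[OF finite_indices[OF assms(3)] assms(2)] by blast

lemma clash_avoids:
  assumes "clash \<tau>"
  shows "a \<notin> \<tau>" "b \<notin> \<tau>" "\<tau> \<noteq> {}"
proof -
  have fin: "finite \<tau>" using assms finite_indices by (simp add: clash_def)
  then show "a \<notin> \<tau>" "b \<notin> \<tau>" using assms generator_mdvd_mdeg[OF fin] by (auto simp: clash_def)
  have "mdeg ls {b} mdvd ls ! b" by (simp add: mdeg_mdvd_iff mdvd_refl)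
  then have "\<not> ls ! a mdvd mdeg ls {b}" using antichain[OF a b] neq mdvd_trans by blast
  then show "\<tau> \<noteq> {}" using assms by (auto simp: clash_def)
qed

text \<open>
  The condition says that adding or removing \<open>a\<close> changes the multidegree, and likewise for
  \<open>b\<close>. This suffices: a set \<open>\<tau>\<close> with the multidegree of \<open>\<sigma>\<close> agrees with it outside \<open>a\<close>, \<open>b\<close>.
  An element of \<open>\<tau> - \<sigma>\<close> could be added to \<open>\<sigma>\<close> without changing the multidegree; so \<open>\<tau> \<subseteq> \<sigma>\<close>,
  and then an element of \<open>\<sigma> - \<tau>\<close> could be removed from \<open>\<sigma>\<close>.
\<close>

lemma scarf_basis_iff:
  assumes \<sigma>: "\<sigma> \<subseteq> {..<length ls}"
  shows "\<sigma> \<in> scarf_basis ls (card \<sigma>) \<longleftrightarrow>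
    \<not> ls ! a mdvd mdeg ls (\<sigma> - {a}) \<and> \<not> ls ! b mdvd mdeg ls (\<sigma> - {b})"
proof
  assume scarf: "\<sigma> \<in> scarf_basis ls (card \<sigma>)"
  have "\<not> ls ! i mdvd mdeg ls (\<sigma> - {i})" if i: "i < length ls" for i
  proof
    assume "ls ! i mdvd mdeg ls (\<sigma> - {i})"
    then have eq: "mdeg ls (insert i \<sigma>) = mdeg ls (\<sigma> - {i})"
      using mdeg_insert[of "\<sigma> - {i}" ls i] finite_indices[OF \<sigma>] by simp
    have "\<tau> = \<sigma>" if "\<tau> \<in> {insert i \<sigma>, \<sigma> - {i}}" for \<tau>
    proof (rule scarf_basisD[OF scarf])
      show "\<tau> \<subseteq> {..<length ls}" using that \<sigma> i by auto
      show "mdeg ls \<tau> = mdeg ls \<sigma>" using that eq by (cases "i \<in> \<sigma>") (auto simp: insert_absorb)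
    qed
    then have "insert i \<sigma> = \<sigma>" "\<sigma> - {i} = \<sigma>" by blast+
    then show False by blast
  qed
  then show "\<not> ls ! a mdvd mdeg ls (\<sigma> - {a}) \<and> \<not> ls ! b mdvd mdeg ls (\<sigma> - {b})" using a b by blast
next
  assume *: "\<not> ls ! a mdvd mdeg ls (\<sigma> - {a}) \<and> \<not> ls ! b mdvd mdeg ls (\<sigma> - {b})"
  have "\<tau> = \<sigma>" if \<tau>: "\<tau> \<subseteq> {..<length ls}" "mdeg ls \<tau> = mdeg ls \<sigma>" for \<tau>
  proof
    have gen: "ls ! i mdvd mdeg ls \<sigma>" if "i \<in> \<tau> \<union> \<sigma>" for i
      using that generator_mdvd_mdeg finite_indices \<sigma> \<tau> by (metis Un_iff)
    show sub: "\<tau> \<subseteq> \<sigma>"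
    proof (rule subsetI, rule ccontr)
      fix i assume i: "i \<in> \<tau>" "i \<notin> \<sigma>"
      then show False using * gen[of i] dom[of i \<sigma>] \<sigma> \<tau>(1) by (cases "i = a \<or> i = b") auto
    qed
    show "\<sigma> \<subseteq> \<tau>"
    proof (rule subsetI, rule ccontr)
      fix i assume i: "i \<in> \<sigma>" "i \<notin> \<tau>"
      then have "ls ! i mdvd mdeg ls \<tau>" using gen[of i] \<tau>(2) by simp
      moreover from this have "ls ! i mdvd mdeg ls (\<sigma> - {i})"
        by (rule mdvd_mdeg_mono) (use i sub \<sigma> in auto)
      ultimately show False using * i dom[of i \<tau>] \<sigma> \<tau>(1) by (cases "i = a \<or> i = b") auto
    qed
  qed
  then show "\<sigma> \<in> scarf_basis ls (card \<sigma>)" using \<sigma> by (auto simp: scarf_basis_def taylor_symbols_def)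
qed

lemma mem_scarf_faces:
  "\<sigma> \<in> scarf_faces ls t \<longleftrightarrow> \<sigma> \<subseteq> {..<length ls} \<and> (\<forall>i\<in>\<sigma>. ls ! i mdvd t) \<and>
    \<not> ls ! a mdvd mdeg ls (\<sigma> - {a}) \<and> \<not> ls ! b mdvd mdeg ls (\<sigma> - {b})"
proof (cases "\<sigma> \<subseteq> {..<length ls}")
  case True
  then show ?thesis
    using scarf_basis_iff[OF True] finite_indices[OF True] by (auto simp: scarf_faces_def mdeg_mdvd_iff)
next
  case False
  then show ?thesis using scarf_faces_Pow[of ls t] by blast
qed

subsection \<open>Stars of the two nondominant vertices\<close>

definition star :: "nat \<Rightarrow> 'x monom \<Rightarrow> nat set set"
  where "star i t = {\<sigma>. insert i \<sigma> \<in> scarf_faces ls t}"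

lemma star_subset: "star i t \<subseteq> scarf_faces ls t"
  using subset_closedD[OF scarf_faces_subset_closed] unfolding star_def by blast

lemma star_Pow: "star i t \<subseteq> Pow {..<length ls}"
  using star_subset scarf_faces_Pow by blast

lemma star_subset_closed: "subset_closed (star i t)"
  unfolding subset_closed_def
proof (intro ballI allI impI)
  fix \<sigma> \<rho> assume "\<sigma> \<in> star i t" "\<rho> \<subseteq> \<sigma>"
  then show "\<rho> \<in> star i t"
    using subset_closedD[OF scarf_faces_subset_closed, of "insert i \<sigma>" ls t "insert i \<rho>"]
    by (auto simp: star_def)
qed

lemma acyclic_star: "i < length ls \<Longrightarrow> acyclic_complex TYPE('k::field) (length ls) (star i t)"
  by (rule acyclic_cone[OF star_Pow star_subset_closed]) (auto simp: star_def)

text \<open>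
  A set in both stars can be enlarged by \<open>a\<close> and \<open>b\<close> together: that \<open>a\<close> is not redundant then is
  already visible after adding \<open>b\<close> alone, and symmetrically. So the intersection of the stars is
  itself a cone.
\<close>

lemma acyclic_star_union:
  "acyclic_complex TYPE('k::field) (length ls) (star a t \<union> star b t)"
proof (rule acyclic_union[OF star_subset_closed star_subset_closed star_Pow])
  show "acyclic_complex TYPE('k) (length ls) (star a t \<inter> star b t)"
  proof (rule acyclic_cone)
    show "star a t \<inter> star b t \<subseteq> Pow {..<length ls}" using star_Pow by blast
    show "subset_closed (star a t \<inter> star b t)"
      using star_subset_closed[of a t] star_subset_closed[of b t] by (auto simp: subset_closed_def)
    fix \<sigma> assume "\<sigma> \<in> star a t \<inter> star b t"
    then have F: "insert a \<sigma> \<in> scarf_faces ls t" "insert b \<sigma> \<in> scarf_faces ls t"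
      by (auto simp: star_def)
    have "insert a (insert b \<sigma>) - {a} = insert b \<sigma> - {a}" "insert a (insert b \<sigma>) - {b} = insert a \<sigma> - {b}"
      by auto
    then have "insert a (insert b \<sigma>) \<in> scarf_faces ls t"
      using F by (simp add: mem_scarf_faces)
    then show "insert a \<sigma> \<in> star a t \<inter> star b t"
      using F by (simp add: star_def insert_commute)
  qed (rule a)
qed (rule acyclic_star[OF a] acyclic_star[OF b])+

text \<open>
  A face that contains neither \<open>a\<close> nor \<open>b\<close> and can be enlarged by neither is a clash.
\<close>

lemma mem_star_union:
  assumes \<sigma>: "\<sigma> \<in> scarf_faces ls t" and t: "ls ! a mdvd t" "ls ! b mdvd t" and "\<not> clash \<sigma>"
  shows "\<sigma> \<in> star a t \<union> star b t"
proof (cases "a \<in> \<sigma> \<or> b \<in> \<sigma>")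
  case True
  then show ?thesis using \<sigma> by (auto simp: star_def insert_absorb)
next
  case False
  then have diff: "\<sigma> - {a} = \<sigma>" "\<sigma> - {b} = \<sigma>" "insert a \<sigma> - {b} = insert a \<sigma>" "insert b \<sigma> - {a} = insert b \<sigma>"
    "insert a \<sigma> - {a} = \<sigma>" "insert b \<sigma> - {b} = \<sigma>"
    using neq by auto
  have "\<not> ls ! a mdvd mdeg ls (insert b \<sigma>) \<or> \<not> ls ! b mdvd mdeg ls (insert a \<sigma>)"
    using assms(4) \<sigma> by (simp add: clash_def mem_scarf_faces diff)
  then show ?thesis using \<sigma> t a b by (auto simp: star_def mem_scarf_faces diff)
qed

lemma acyclic_if_no_clash:
  assumes "\<And>\<tau>. \<not> clash \<tau>" and i: "i < length ls" "ls ! i mdvd t"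
  shows "acyclic_complex TYPE('k::field) (length ls) (scarf_faces ls t)"
proof (cases "ls ! a mdvd t \<and> ls ! b mdvd t")
  case True
  then have "scarf_faces ls t = star a t \<union> star b t"
    using mem_star_union star_subset assms(1) by blast
  then show ?thesis using acyclic_star_union by metis
next
  case False
  \<comment> \<open>The complex is a cone. If neither \<open>a\<close> nor \<open>b\<close> divides \<open>t\<close>, any generator that does can
    be the apex; otherwise it must be the one of \<open>a\<close>, \<open>b\<close> that does, since adding another vertex
    could create a set whose lcm this one divides.\<close>
  define v where "v = (if ls ! a mdvd t then a else if ls ! b mdvd t then b else i)"
  have v: "v < length ls" "ls ! v mdvd t" using a b i by (auto simp: v_def)
  have "insert v \<sigma> \<in> scarf_faces ls t" if \<sigma>: "\<sigma> \<in> scarf_faces ls t" for \<sigma>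
  proof -
    have n: "insert v \<sigma> \<subseteq> {..<length ls}" and div: "\<forall>j\<in>insert v \<sigma>. ls ! j mdvd t"
      using \<sigma> v by (auto simp: mem_scarf_faces)
    have nd: "\<not> ls ! j mdvd mdeg ls (insert v \<sigma> - A)" if "\<not> ls ! j mdvd t" for j A
    proof
      assume "ls ! j mdvd mdeg ls (insert v \<sigma> - A)"
      moreover have "mdeg ls (insert v \<sigma> - A) mdvd t"
        using div finite_indices[OF n] by (subst mdeg_mdvd_iff) auto
      ultimately show False using that mdvd_trans by blast
    qed
    have same: "\<not> ls ! j mdvd mdeg ls (insert v \<sigma> - {j})" if "j = v" "j = a \<or> j = b" for j
    proof -
      have "insert v \<sigma> - {j} = \<sigma> - {j}" using that by auto
      then show ?thesis using \<sigma> that by (auto simp: mem_scarf_faces)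
    qed
    have "\<not> ls ! j mdvd mdeg ls (insert v \<sigma> - {j})" if "j = a \<or> j = b" for j
      using nd[of j "{j}"] same[of j] that False by (cases "j = v") (auto simp: v_def split: if_splits)
    then show ?thesis using n div by (auto simp: mem_scarf_faces)
  qed
  then show ?thesis by (rule acyclic_cone[OF scarf_faces_Pow scarf_faces_subset_closed v(1)])
qed

text \<open>
  A least clash would be a face whose boundary bounds elsewhere in the complex, giving a cycle
  that cannot bound because the clash has no coface. The choice of \<open>t\<close> as the lcm of the clash
  with \<open>a\<close> and \<open>b\<close> keeps other dominant generators from dividing \<open>t\<close>.
\<close>

lemma no_clash_if_scarf:
  fixes M :: "('x, 'k::field) mpoly set"
  assumes scarf: "scarf ls M"
  shows "\<not> clash \<tau>0"
proof
  let ?n = "length ls"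
  assume "clash \<tau>0"
  then obtain \<tau> where clash: "clash \<tau>" and least: "\<And>\<rho>. clash \<rho> \<Longrightarrow> card \<tau> \<le> card \<rho>"
    using ex_has_least_nat[of clash _ card] by blast
  have n: "\<tau> \<subseteq> {..<?n}" using clash by (simp add: clash_def)
  have fin: "finite \<tau>" by (rule finite_indices[OF n])
  have ab: "a \<notin> \<tau>" "b \<notin> \<tau>" using clash_avoids[OF clash] by auto
  obtain j where j: "card \<tau> = Suc j"
    using clash_avoids(3)[OF clash] fin by (metis card_0_eq not0_implies_Suc)
  define t where "t = mdeg ls (insert a (insert b \<tau>))"
  have t: "ls ! i mdvd t" if "i = a \<or> i = b \<or> i \<in> \<tau>" for i
    unfolding t_def using that fin by (intro generator_mdvd_mdeg) auto
  have diff: "\<tau> - {a} = \<tau>" "\<tau> - {b} = \<tau>" "insert a \<tau> - {b} = insert a \<tau>" "insert b \<tau> - {a} = insert b \<tau>"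
    using ab neq by auto
  have \<tau>: "\<tau> \<in> scarf_faces ls t" using clash t by (simp add: mem_scarf_faces diff clash_def)
  have no_coface: "insert r \<tau> \<notin> scarf_faces ls t" if r: "r \<notin> \<tau>" for r
  proof
    assume F: "insert r \<tau> \<in> scarf_faces ls t"
    then have "r < ?n" "ls ! r mdvd t" by (auto simp: mem_scarf_faces)
    then have "r = a \<or> r = b"
      using dom[of r "insert a (insert b \<tau>)"] r n a b unfolding t_def by auto
    then show False using F clash by (auto simp: mem_scarf_faces diff clash_def)
  qed
  let ?K = "star a t \<union> star b t"
  have \<tau>_notin: "\<tau> \<notin> ?K" using no_coface ab by (auto simp: star_def)
  have proper: "\<rho> \<in> ?K" if "\<rho> \<subset> \<tau>" for \<rho>
  proof (rule mem_star_union)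
    show "\<rho> \<in> scarf_faces ls t" using subset_closedD[OF scarf_faces_subset_closed \<tau>] that by blast
    show "\<not> clash \<rho>" using least[of \<rho>] psubset_card_mono[OF fin that] by auto
  qed (use t in auto)
  \<comment> \<open>The chain \<open>\<tau>\<close> itself; its boundary lives on the proper subsets of \<open>\<tau>\<close>.\<close>
  define e :: "nat set \<Rightarrow> 'k" where "e = (\<lambda>\<sigma>. if \<sigma> = \<tau> then 1 else 0)"
  have e0: "bdry ?n e \<rho> = 0" if "\<not> \<rho> \<subset> \<tau>" for \<rho>
  proof -
    have "insert r \<rho> \<noteq> \<tau>" if "r \<notin> \<rho>" for r using \<open>\<not> \<rho> \<subset> \<tau>\<close> that by auto
    then show ?thesis by (simp add: bdry_def e_def)
  qed
  have e_card: "bdry ?n e \<rho> = 0" if "card \<rho> \<noteq> j" for \<rho>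
  proof -
    have "insert r \<rho> \<noteq> \<tau>" if "r \<notin> \<rho>" for r
      using \<open>card \<rho> \<noteq> j\<close> that j fin by (metis card_insert_disjoint finite_insert nat.inject)
    then show ?thesis by (simp add: bdry_def e_def)
  qed
  have "supported_on ?K (bdry ?n e)"
    unfolding supported_on_def using proper e0 by blast
  moreover have "bdry ?n (bdry ?n e) = (\<lambda>_. 0)"
    by (rule bdry_bdry) (use n in \<open>auto simp: supported_on_def e_def\<close>)
  ultimately obtain w where w: "supported_on ?K w" "bdry ?n w = bdry ?n e"
    using acyclic_star_union[of t, where ?'k = 'k] unfolding acyclic_complex_def by blast
  \<comment> \<open>Only chains concentrated in one cardinality lift to the Scarf complex in a single degree.\<close>
  define w' where "w' = (\<lambda>\<sigma>. if card \<sigma> = Suc j then w \<sigma> else 0)"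
  define c where "c = (\<lambda>\<sigma>. e \<sigma> - w' \<sigma>)"
  have "supported_on (Pow {..<?n}) w" using w(1) star_Pow unfolding supported_on_def by blast
  then have "bdry ?n w' \<rho> = bdry ?n e \<rho>" for \<rho>
    using e_card[of \<rho>] unfolding w'_def by (simp add: bdry_restrict_card w(2))
  then have "bdry ?n c = (\<lambda>_. 0)" unfolding c_def by (simp add: bdry_diff fun_eq_iff)
  moreover have "supported_on {\<sigma> \<in> scarf_faces ls t. card \<sigma> = Suc j} c"
    unfolding supported_on_def
  proof (intro allI impI)
    fix \<sigma> assume \<sigma>: "\<sigma> \<notin> {\<sigma> \<in> scarf_faces ls t. card \<sigma> = Suc j}"
    then have "e \<sigma> = 0" using \<tau> j by (auto simp: e_def)
    moreover have "w' \<sigma> = 0"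
      using \<sigma> supported_onD[OF w(1), of \<sigma>] star_subset[of a t] star_subset[of b t]
      by (auto simp: w'_def)
    ultimately show "c \<sigma> = 0" by (simp add: c_def)
  qed
  ultimately obtain v where v: "supported_on (scarf_faces ls t) v" "bdry ?n v = c"
    using scarf_imp_exact[OF scarf] by blast
  have "v (insert r \<tau>) = 0" if "r \<notin> \<tau>" for r using supported_onD[OF v(1) no_coface[OF that]] .
  then have "bdry ?n v \<tau> = 0" by (simp add: bdry_def)
  moreover have "c \<tau> = 1" using supported_onD[OF w(1) \<tau>_notin] by (simp add: c_def e_def w'_def)
  ultimately show False using v(2) by simp
qed

subsection \<open>Parity of the fibres of the multidegree\<close>

lemma mem_basis_of_mdeg: "\<sigma> \<in> basis_of_mdeg ls m \<longleftrightarrow> \<sigma> \<subseteq> {..<length ls} \<and> mdeg ls \<sigma> = m"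
  by (simp add: basis_of_mdeg_def taylor_symbols_def)

text \<open>
  A dominant index belongs to a set iff its generator divides the multidegree. With the roles of
  the two sets exchanged, equality follows.
\<close>

lemma basis_of_mdeg_dominant_part:
  assumes "\<sigma> \<in> basis_of_mdeg ls m" "\<rho> \<in> basis_of_mdeg ls m"
  shows "\<sigma> - {a, b} \<subseteq> \<rho> - {a, b}"
proof
  fix i assume i: "i \<in> \<sigma> - {a, b}"
  then have "ls ! i mdvd mdeg ls \<sigma>"
    using assms(1) generator_mdvd_mdeg[OF finite_indices] by (auto simp: mem_basis_of_mdeg)
  then show "i \<in> \<rho> - {a, b}" using i assms dom[of i \<rho>] by (auto simp: mem_basis_of_mdeg)
qed

lemma card_basis_of_mdeg:
  assumes \<tau>: "\<tau> = \<sigma> - {a, b}" and \<sigma>: "\<sigma> \<in> basis_of_mdeg ls m"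
  defines "B \<equiv> basis_of_mdeg ls m"
  shows "card B = of_bool (\<tau> \<in> B) + of_bool (insert a \<tau> \<in> B) + of_bool (insert b \<tau> \<in> B)
    + of_bool (insert a (insert b \<tau>) \<in> B)"
proof -
  let ?Q = "{\<tau>, insert a \<tau>, insert b \<tau>, insert a (insert b \<tau>)}"
  have "B \<subseteq> ?Q"
  proof
    fix \<rho> assume "\<rho> \<in> B"
    then have "\<rho> - {a, b} = \<tau>"
      using basis_of_mdeg_dominant_part \<sigma> \<tau> unfolding B_def by blast
    then show "\<rho> \<in> ?Q" by blast
  qed
  then have "card B = (\<Sum>\<rho>\<in>?Q. of_bool (\<rho> \<in> B))"
    unfolding card_eq_sum by (intro sum.mono_neutral_cong_left) auto
  moreover have "a \<notin> \<tau>" "b \<notin> \<tau>" using \<tau> by auto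
  then have "insert a \<tau> \<noteq> insert b \<tau>" "insert a \<tau> \<noteq> insert a (insert b \<tau>)"
      "insert b \<tau> \<noteq> insert a (insert b \<tau>)" "\<tau> \<noteq> insert a \<tau>" "\<tau> \<noteq> insert b \<tau>" "\<tau> \<noteq> insert a (insert b \<tau>)"
    using neq by (metis insert_iff)+
  ultimately show ?thesis by simp
qed

text \<open>
  Fibres of the multidegree are closed under unions and under passing to sets in between. The only
  remaining way to have three elements is to miss \<open>\<tau>\<close> alone, which is a clash.
\<close>

lemma even_card_if_no_clash:
  assumes "\<And>\<tau>. \<not> clash \<tau>" and "m \<in> shared_mdegs ls"
  shows "even (card (basis_of_mdeg ls m))"
proof -
  let ?B = "basis_of_mdeg ls m"
  have gt: "card ?B > 1" using assms(2) by (simp add: shared_mdegs_def)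
  then obtain \<sigma> where \<sigma>: "\<sigma> \<in> ?B" by fastforce
  define \<tau> where "\<tau> = \<sigma> - {a, b}"
  have n: "\<tau> \<subseteq> {..<length ls}" using \<sigma> by (auto simp: \<tau>_def mem_basis_of_mdeg)
  then have na: "insert a \<tau> \<subseteq> {..<length ls}" and nb: "insert b \<tau> \<subseteq> {..<length ls}"
    and nab: "insert a (insert b \<tau>) \<subseteq> {..<length ls}" using a b by auto
  note fin = finite_indices[OF n]
  have mono: "mdeg ls \<rho> mdvd mdeg ls \<rho>'" if "\<rho> \<subseteq> \<rho>'" "\<rho>' \<subseteq> insert a (insert b \<tau>)" for \<rho> \<rho>'
    using that finite_subset[OF that(2)] fin by (intro mdeg_mono) auto
  have 1: "insert a (insert b \<tau>) \<in> ?B \<and> \<tau> \<in> ?B" if "insert a \<tau> \<in> ?B" "insert b \<tau> \<in> ?B"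
  proof -
    have div: "ls ! b mdvd mdeg ls (insert a \<tau>)" "ls ! a mdvd mdeg ls (insert b \<tau>)"
      using that generator_mdvd_mdeg[of "insert b \<tau>" b ls] generator_mdvd_mdeg[of "insert a \<tau>" a ls] fin
      by (auto simp: mem_basis_of_mdeg)
    have "mdeg ls (insert a (insert b \<tau>)) = m"
      using mdeg_insert[of "insert b \<tau>" ls a] div fin that by (simp add: mem_basis_of_mdeg)
    moreover have "mdeg ls \<tau> = m"
      using assms(1)[of \<tau>] div n mdeg_insert[OF fin, of ls a] mdeg_insert[OF fin, of ls b] that
      by (auto simp: clash_def mem_basis_of_mdeg)
    ultimately show ?thesis using n nab by (simp add: mem_basis_of_mdeg)
  qed
  have 2: "insert i \<tau> \<in> ?B" if "insert a (insert b \<tau>) \<in> ?B" "\<tau> \<in> ?B" "i = a \<or> i = b" for i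
  proof -
    have "mdeg ls (insert i \<tau>) mdvd mdeg ls (insert a (insert b \<tau>))" "mdeg ls \<tau> mdvd mdeg ls (insert i \<tau>)"
      by (rule mono; use that in auto)+
    then have "mdeg ls (insert i \<tau>) = m" using that mdvd_antisym by (simp add: mem_basis_of_mdeg)
    then show ?thesis using that na nb by (auto simp: mem_basis_of_mdeg)
  qed
  have 3: "\<tau> \<in> ?B \<longrightarrow> insert a \<tau> \<in> ?B \<and> insert b \<tau> \<in> ?B" if "insert a (insert b \<tau>) \<in> ?B"
    using that 2 by blast
  show ?thesis
    unfolding card_basis_of_mdeg[OF \<tau>_def \<sigma>]
    by (rule even_of_four_bools[OF gt[unfolded card_basis_of_mdeg[OF \<tau>_def \<sigma>]]])
      (use 1 3 in blast)+
qed

lemma clash_odd_card: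
  assumes "clash \<tau>"
  shows "card (basis_of_mdeg ls (mdeg ls (insert a \<tau>))) = 3"
proof -
  let ?m = "mdeg ls (insert a \<tau>)"
  let ?B = "basis_of_mdeg ls ?m"
  have n: "\<tau> \<subseteq> {..<length ls}" using assms by (simp add: clash_def)
  note fin = finite_indices[OF n]
  have "mdeg ls (insert a (insert b \<tau>)) = ?m"
    using mdeg_insert[of "insert a \<tau>" ls b] assms fin by (simp add: clash_def insert_commute)
  moreover have "mdeg ls (insert a (insert b \<tau>)) = mdeg ls (insert b \<tau>)"
    using mdeg_insert[of "insert b \<tau>" ls a] assms fin by (simp add: clash_def)
  moreover have "mdeg ls \<tau> \<noteq> ?m"
    using mdeg_insert[OF fin, of ls a] assms by (auto simp: clash_def)
  ultimately have "\<tau> \<notin> ?B" "insert a \<tau> \<in> ?B" "insert b \<tau> \<in> ?B" "insert a (insert b \<tau>) \<in> ?B"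
    using n a b by (auto simp: mem_basis_of_mdeg)
  moreover have "\<tau> = insert a \<tau> - {a, b}" using clash_avoids[OF assms] by auto
  ultimately show ?thesis using card_basis_of_mdeg[of \<tau> "insert a \<tau>" ?m] by simp
qed

lemma even_card_iff_no_clash:
  "(\<forall>m\<in>shared_mdegs ls. even (card (basis_of_mdeg ls m))) \<longleftrightarrow> (\<forall>\<tau>. \<not> clash \<tau>)"
proof
  assume even: "\<forall>m\<in>shared_mdegs ls. even (card (basis_of_mdeg ls m))"
  show "\<forall>\<tau>. \<not> clash \<tau>"
  proof (intro allI notI)
    fix \<tau> assume "clash \<tau>"
    then have 3: "card (basis_of_mdeg ls (mdeg ls (insert a \<tau>))) = 3" by (rule clash_odd_card)
    then have "mdeg ls (insert a \<tau>) \<in> shared_mdegs ls" by (simp add: shared_mdegs_def)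
    then show False using even 3 by fastforce
  qed
qed (use even_card_if_no_clash in blast)

lemma unit_notin: "0 \<notin> set ls"
proof
  assume "0 \<in> set ls"
  then obtain i where "i < length ls" "ls ! i = 0" by (auto simp: in_set_conv_nth)
  then show False using antichain[of i a] antichain[of i b] a b neq by (simp add: mdvd_zero)
qed

lemma scarf_iff_no_clash:
  fixes M :: "('x, 'k::field) mpoly set"
  assumes M: "ideal_of (mon ` set ls) = M"
  shows "scarf ls M \<longleftrightarrow> (\<forall>\<tau>. \<not> clash \<tau>)"
proof
  assume "\<forall>\<tau>. \<not> clash \<tau>"
  then show "scarf ls M" by (intro scarf_if_acyclic[OF M unit_notin] acyclic_if_no_clash) auto
qed (use no_clash_if_scarf in blast)

end

theorem theorem6p7:
  fixes M :: "('x::finite, 'k::field) mpoly set"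
    and ls :: "'x monom list"
  assumes "two_semidominant M"
    and "distinct ls" and "minimal_generating_set (set ls) M"
  shows "scarf ls M \<longleftrightarrow> (\<forall>m\<in>shared_mdegs ls. even (card (basis_of_mdeg ls m)))"
proof -
  obtain G where G: "minimal_generating_set G M" "card {m \<in> G. \<not> dominant G m} = 2"
    using assms(1) unfolding two_semidominant_def by blast
  have "G = set ls" using minimal_generators_unique[OF G(1) assms(3)] .
  with G(2) obtain p q where pq: "{m \<in> set ls. \<not> dominant (set ls) m} = {p, q}" "p \<noteq> q"
    unfolding card_2_iff by blast
  then have "p \<in> set ls" "q \<in> set ls" by blast+
  then obtain a b where ab: "a < length ls" "ls ! a = p" "b < length ls" "ls ! b = q"
    unfolding in_set_conv_nth by blast
  interpret two_nondominant ls a b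
  proof
    show "a < length ls" "b < length ls" "a \<noteq> b" using ab pq(2) by auto
    show "i = j" if "i < length ls" "j < length ls" "ls ! i mdvd ls ! j" for i j
      using minimal_generators_antichain[OF assms(3) _ _ that(3)] that assms(2)
      by (simp add: nth_eq_iff_index_eq)
    show "i \<in> \<sigma>" if i: "i < length ls" "i \<noteq> a" "i \<noteq> b"
      and \<sigma>: "\<sigma> \<subseteq> {..<length ls}" "ls ! i mdvd mdeg ls \<sigma>" for i \<sigma>
    proof (rule dominant_mdvd_mdeg[OF _ assms(2) i(1) \<sigma>])
      have "ls ! i \<notin> {p, q}" using i ab assms(2) by (auto simp: nth_eq_iff_index_eq)
      then show "dominant (set ls) (ls ! i)" using pq(1) nth_mem[OF i(1)] by blast
    qed
  qed
  have "ideal_of (mon ` set ls) = M" using assms(3) by (simp add: minimal_generating_set_def)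
  then show ?thesis by (simp only: scarf_iff_no_clash even_card_iff_no_clash)
qed

end
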